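(* Let $0<\alpha<2$, let $d\geq 1$ be an integer, and let $D=\{x=(x_1,\ldots,x_d)\in\mathbb{R}^d : x_d>0\}$. Put $$\kappa_{d,\alpha}=\frac{\pi^{\frac{d-1}{2}}\,\Gamma\left(\frac{1+\alpha}{2}\right)}{\Gamma\left(\frac{\alpha+d}{2}\right)}\cdot\frac{B\left(\frac{1+\alpha}{2},\frac{2-\alpha}{2}\right)-2^{\alpha}}{\alpha 2^{\alpha}}.$$ Then for every $u\in C_c(D)$, $$\frac12\int_D\int_D\frac{(u(x)-u(y))^2}{|x-y|^{d+\alpha}}\,dx\,dy\;\geq\;\kappa_{d,\alpha}\int_D u^2(x)\,x_d^{-\alpha}\,dx .$$ Moreover, the constant is optimal: for every real $\kappa>\kappa_{d,\alpha}$ there exists $u\in C_c(D)$ such that $$\frac12\int_D\int_D\frac{(u(x)-u(y))^2}{|x-y|^{d+\alpha}}\,dx\,dy\;<\;\kappa\int_D u^2(x)\,x_d^{-\alpha}\,dx .$$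
   Context: $C_c(D)$ is the class of all continuous functions $u:\mathbb{R}^d\to\mathbb{R}$ with compact support contained in $D$. $|\cdot|$ is the Euclidean norm, $\Gamma$ is the Euler gamma function and $B(a,b)=\int_0^1 t^{a-1}(1-t)^{b-1}\,dt=\Gamma(a)\Gamma(b)/\Gamma(a+b)$ is the Euler beta function. The double integral on the left-hand side takes values in $[0,\infty]$. *)

theory Defs
  imports "HOL-Analysis.Analysis"
begin

text \<open>
  Points of \<open>\<real>\<^sup>d\<close> are vectors of type \<open>real ^ 'n\<close> with \<open>d = CARD('n)\<close>. An index type carries no
  intrinsic order, so the coordinate that plays the role of the last one is a parameter \<open>k :: 'n\<close>.
\<close>

definition half_space :: "'n::finite \<Rightarrow> (real ^ 'n) set" where
  "half_space k = {x. x $ k > 0}"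

text \<open>Functions on the whole space whose topological support is compact and contained in \<open>D\<close>.\<close>

definition Cc :: "(real ^ 'n::finite) set \<Rightarrow> (real ^ 'n \<Rightarrow> real) set" where
  "Cc D = {u. continuous_on UNIV u \<and> compact (closure {x. u x \<noteq> 0}) \<and> closure {x. u x \<noteq> 0} \<subseteq> D}"

text \<open>
  Both integrals are integrals of nonnegative functions and are taken in \<open>[0, \<infinity>]\<close>; in particular
  no convention about non-integrable functions is involved. On the diagonal the integrand of
  \<open>energy\<close> is \<open>0\<close>; the diagonal is a null set.
\<close>

definition energy :: "real \<Rightarrow> (real ^ 'n::finite) set \<Rightarrow> (real ^ 'n \<Rightarrow> real) \<Rightarrow> ennreal" where
  "energy \<alpha> D u = (1/2) *
     (\<integral>\<^sup>+y\<in>D. (\<integral>\<^sup>+x\<in>D. ennreal ((u x - u y)\<^sup>2 / norm (x - y) powr (real CARD('n) + \<alpha>)) \<partial>lborel) \<partial>lborel)"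

definition hardy_integral :: "real \<Rightarrow> 'n::finite \<Rightarrow> (real ^ 'n \<Rightarrow> real) \<Rightarrow> ennreal" where
  "hardy_integral \<alpha> k u =
     (\<integral>\<^sup>+x\<in>half_space k. ennreal ((u x)\<^sup>2 * (x $ k) powr (-\<alpha>)) \<partial>lborel)"

text \<open>
  For a real \<open>c \<le> 0\<close> the embedding gives \<open>ennreal c = 0\<close>. A comparison \<open>L \<ge> ennreal c * I\<close> or
  \<open>L < ennreal c * I\<close> with \<open>L \<ge> 0\<close> and \<open>0 \<le> I < \<infinity>\<close> is unaffected: then the first is true and
  the second false, exactly as for \<open>c * I\<close>.
\<close>

definition kappa :: "nat \<Rightarrow> real \<Rightarrow> real" where
  "kappa d \<alpha> =
     pi powr ((real d - 1) / 2) * Gamma ((1 + \<alpha>) / 2) / Gamma ((\<alpha> + real d) / 2) *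
     ((Beta ((1 + \<alpha>) / 2) ((2 - \<alpha>) / 2) - 2 powr \<alpha>) / (\<alpha> * 2 powr \<alpha>))"

end

theory Submission
  imports Defs "HOL-Probability.Probability"
begin

text \<open>
  The idea is the ground state representation with respect to \<open>w(x) = x\<^sub>k powr p\<close>, \<open>p = (\<alpha> - 1) / 2\<close>.
  For \<open>u = w v\<close> one has pointwise
  \<open>(u(x) - u(y))\<^sup>2 = u(x)\<^sup>2 (1 - w(y)/w(x)) + u(y)\<^sup>2 (1 - w(x)/w(y)) + w(x) w(y) (v(x) - v(y))\<^sup>2\<close>.
  The singular set is removed by the multiplicative cut-off \<open>\<bar>ln x\<^sub>k - ln y\<^sub>k\<bar> > \<delta>\<close>, which is symmetric and
  invariant under dilations. Integrating out the directions parallel to the boundary leaves the kernel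
  \<open>\<bar>x\<^sub>k - y\<^sub>k\<bar> powr (-1 - \<alpha>)\<close>, and in the variable \<open>r = ln x\<^sub>k - ln y\<^sub>k\<close> the first two terms
  give exactly a multiple of the Hardy integral: the multiple is the integral of
  \<open>(cosh (p r) - 1) (2 sinh (\<bar>r\<bar>/2)) powr (-1 - \<alpha>)\<close> over \<open>\<bar>r\<bar> > \<delta>\<close>. As \<open>\<delta>\<close> tends to \<open>0\<close> this yields the
  inequality, with the term in \<open>v\<close> as remainder. For optimality the remainder is made small compared
  with the Hardy integral by \<open>v(x) = V(ln x\<^sub>k / n) \<psi>(x / R)\<close>, where \<open>n\<close> and then \<open>R\<close> are large and
  \<open>\<psi>\<close> depends on the coordinates other than the \<open>k\<close>-th.
\<close>

subsection \<open>Integration over hyperplanes parallel to the boundary\<close>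

text \<open>The exponent \<open>p\<close> is forced by scaling. In logarithmic heights, with
  \<open>r = ln (x $ k) - ln (y $ k)\<close>, measure and kernel leave the factor
  \<open>exp (- p * r)\<close> besides an even kernel in \<open>r\<close>, and the ratio
  \<open>w(x) / w(y) = exp (p * r)\<close> cancels exactly this factor. The remainder form is
  therefore invariant under translations of the logarithmic height, and a profile of width
  \<open>n\<close> has a remainder of order \<open>1 / n\<close> against a Hardy integral of order
  \<open>n\<close>. The obstacle is the diagonal: for \<alpha> > 1 each of the two terms with a
  factor such as \<open>1 - w(y)/w(x)\<close> has only a first-order zero there and is not
  absolutely integrable. Only their sum over \<open>r\<close> and \<open>- r\<close> has the
  second-order zero of \<open>cosh (p * r) - 1\<close>. A cut-off by the ratio of the heights,
  unlike one by the distance of the points, leaves the same integral over \<open>r\<close> at every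
  point. The order of the limits matters because the trial function lives on heights between
  \<open>exp (- n)\<close> and \<open>exp n\<close>: the error caused by the tangential cut-off
  carries a constant that depends on \<open>n\<close> in an uncontrolled way, so \<open>R\<close>
  has to be chosen last.\<close>

lemma measurable_vec_nth [measurable]: "(\<lambda>x::real^'n::finite. x $ k) \<in> borel_measurable borel"
  by (intro borel_measurable_continuous_onI continuous_intros)

lemma nn_integral_vec_prod:
  fixes f :: "'n::finite \<Rightarrow> real \<Rightarrow> ennreal"
  assumes [measurable]: "\<And>i. f i \<in> borel_measurable borel"
  shows "(\<integral>\<^sup>+x. (\<Prod>i\<in>UNIV. f i ((x::real^'n) $ i)) \<partial>lborel) = (\<Prod>i\<in>UNIV. \<integral>\<^sup>+t. f i t \<partial>lborel)"
proof -
  define ix where "ix = inv (\<lambda>i::'n. axis i (1::real))"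
  have inj: "inj (\<lambda>i::'n. axis i (1::real))"
    by (auto simp: inj_def axis_eq_axis)
  have ix: "ix (axis i 1) = i" for i
    unfolding ix_def using inj by (rule inv_f_f)
  have Basis: "(Basis :: (real^'n) set) = range (\<lambda>i. axis i 1)"
    by (auto simp: Basis_vec_def)
  have "(\<integral>\<^sup>+x. (\<Prod>b\<in>Basis. f (ix b) ((x::real^'n) \<bullet> b)) \<partial>lborel) = (\<Prod>b\<in>(Basis::(real^'n) set). \<integral>\<^sup>+t. f (ix b) t \<partial>lborel)"
    by (rule nn_integral_lborel_prod) auto
  then show ?thesis
    unfolding Basis by (simp add: prod.reindex[OF inj] o_def ix inner_axis)
qed

text \<open>The substitution is made on the compact intervals between \<open>- Suc n\<close> and
  \<open>Suc n\<close>, and monotone convergence does the rest. \<open>Suc n\<close> in place of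
  \<open>n\<close> keeps the intervals nondegenerate.\<close>

lemma nn_integral_exp_subst:
  fixes G :: "real \<Rightarrow> ennreal"
  assumes [measurable]: "G \<in> borel_measurable borel"
  shows "(\<integral>\<^sup>+t. G t * indicator {0<..} t \<partial>lborel) = (\<integral>\<^sup>+r. G (exp r) * ennreal (exp r) \<partial>lborel)"
proof -
  have eq: "(\<integral>\<^sup>+t. G t * indicator {exp (- real (Suc n))..exp (real (Suc n))} t \<partial>lborel)
      = (\<integral>\<^sup>+r. G (exp r) * ennreal (exp r) * indicator {- real (Suc n)..real (Suc n)} r \<partial>lborel)" for n
    by (rule nn_integral_substitution_aux) (auto intro!: derivative_eq_intros continuous_intros)
  have 1: "(SUP n. G t * indicator {exp (- real (Suc n))..exp (real (Suc n))} t) = G t * indicator {0<..} t" for t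
  proof (cases "t > 0")
    case True
    obtain n where n: "\<bar>ln t\<bar> \<le> real n" using real_arch_simple by blast
    have "exp (- real (Suc n)) \<le> exp (ln t)" "exp (ln t) \<le> exp (real (Suc n))" using n by auto
    then have "t \<in> {exp (- real (Suc n))..exp (real (Suc n))}" using True by auto
    then have "G t * indicator {0<..} t \<le> (SUP n. G t * indicator {exp (- real (Suc n))..exp (real (Suc n))} t)"
      by (intro SUP_upper2[of n]) (auto simp: True)
    moreover have "(SUP n. G t * indicator {exp (- real (Suc n))..exp (real (Suc n))} t) \<le> G t * indicator {0<..} t"
      by (intro SUP_least) (auto simp: True split: split_indicator)
    ultimately show ?thesis by (intro antisym)
  next
    case False
    have "\<not> exp (- real (Suc n)) \<le> t" for n using exp_gt_zero[of "- real (Suc n)"] False by linarith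
    then show ?thesis using False by (simp add: indicator_def)
  qed
  have 2: "(SUP n. H * indicator {- real (Suc n)..real (Suc n)} r) = H" for H :: ennreal and r
  proof -
    obtain n where n: "\<bar>r\<bar> \<le> real n" using real_arch_simple by blast
    have "H \<le> (SUP n. H * indicator {- real (Suc n)..real (Suc n)} r)"
      by (intro SUP_upper2[of n]) (use n in \<open>auto simp: indicator_def\<close>)
    moreover have "(SUP n. H * indicator {- real (Suc n)..real (Suc n)} r) \<le> H"
      by (intro SUP_least) (auto split: split_indicator)
    ultimately show ?thesis by (intro antisym)
  qed
  have inc1: "incseq (\<lambda>n t. G t * indicator {exp (- real (Suc n))..exp (real (Suc n))} t)"
  proof (intro incseq_SucI le_funI mult_left_mono)
    fix n t
    have *: "a \<le> b \<Longrightarrow> c \<le> d \<Longrightarrow> indicator {b..c} t \<le> (indicator {a..d} t :: ennreal)" for a b c d :: real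
      by (auto simp: indicator_def)
    show "indicator {exp (- real (Suc n))..exp (real (Suc n))} t \<le> (indicator {exp (- real (Suc (Suc n)))..exp (real (Suc (Suc n)))} t :: ennreal)"
      by (rule *) auto
  qed simp
  have inc2: "incseq (\<lambda>n r. G (exp r) * ennreal (exp r) * indicator {- real (Suc n)..real (Suc n)} r)"
    by (intro incseq_SucI le_funI mult_left_mono) (auto simp: indicator_def)
  have "(\<integral>\<^sup>+t. G t * indicator {0<..} t \<partial>lborel) = (SUP n. \<integral>\<^sup>+t. G t * indicator {exp (- real (Suc n))..exp (real (Suc n))} t \<partial>lborel)"
    unfolding 1[symmetric]
    by (rule nn_integral_monotone_convergence_SUP[OF inc1]) measurable
  also have "\<dots> = (SUP n. \<integral>\<^sup>+r. G (exp r) * ennreal (exp r) * indicator {- real (Suc n)..real (Suc n)} r \<partial>lborel)"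
    by (simp only: eq)
  also have "\<dots> = (\<integral>\<^sup>+r. (SUP n. G (exp r) * ennreal (exp r) * indicator {- real (Suc n)..real (Suc n)} r) \<partial>lborel)"
    by (rule nn_integral_monotone_convergence_SUP[OF inc2, symmetric]) measurable
  finally show ?thesis by (simp only: 2)
qed

text \<open>Read from right to left, this writes a power of \<open>A\<close> as a superposition of
  exponentials. With \<open>A\<close> a squared distance these are Gaussians, which factor over
  coordinates.\<close>

lemma nn_integral_Gamma:
  assumes s: "s > 0" and A: "A > 0"
  shows "(\<integral>\<^sup>+t. ennreal (t powr (s - 1) * exp (- t * A)) * indicator {0<..} t \<partial>lborel) = ennreal (Gamma s * A powr (-s))"
proof -
  have "((\<lambda>t. t powr (s - 1) / exp t) has_integral Gamma s) {0..}"
    using Gamma_integral_real[OF s] .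
  then have "(\<integral>\<^sup>+t. ennreal (indicator {0..} t * (t powr (s - 1) / exp t)) \<partial>lborel) = ennreal (Gamma s)"
    by (intro nn_integral_has_integral_lebesgue) auto
  then have "ennreal (Gamma s) = (\<integral>\<^sup>+t. ennreal (indicator {0..} t * (t powr (s - 1) / exp t)) \<partial>lborel)" ..
  also have "(\<integral>\<^sup>+t. ennreal (indicator {0..} t * (t powr (s - 1) / exp t)) \<partial>lborel) =
     (\<integral>\<^sup>+t. ennreal (t powr (s - 1) * exp (-t)) * indicator {0<..} t \<partial>lborel)"
    by (rule nn_integral_cong_AE, rule AE_mp[OF AE_lborel_singleton[of 0]], rule AE_I2)
       (auto split: split_indicator simp: exp_minus divide_inverse)
  also have "\<dots> = ennreal A * (\<integral>\<^sup>+t. ennreal ((A * t) powr (s - 1) * exp (- (A * t))) * indicator {0<..} (A * t) \<partial>lborel)"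
    using A by (subst nn_integral_real_affine[where c = A and t = 0]) auto
  also have "(\<integral>\<^sup>+t. ennreal ((A * t) powr (s - 1) * exp (- (A * t))) * indicator {0<..} (A * t) \<partial>lborel)
    = (\<integral>\<^sup>+t. ennreal (A powr (s - 1)) * (ennreal (t powr (s - 1) * exp (- t * A)) * indicator {0<..} t) \<partial>lborel)"
    using A by (intro nn_integral_cong)
       (auto split: split_indicator simp: powr_mult zero_less_mult_iff ennreal_mult[symmetric] mult_ac)
  also have "\<dots> = ennreal (A powr (s - 1)) * (\<integral>\<^sup>+t. ennreal (t powr (s - 1) * exp (- t * A)) * indicator {0<..} t \<partial>lborel)"
    by (rule nn_integral_cmult) measurable
  also have "ennreal A * (ennreal (A powr (s - 1)) * (\<integral>\<^sup>+t. ennreal (t powr (s - 1) * exp (- t * A)) * indicator {0<..} t \<partial>lborel))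
     = ennreal (A powr s) * (\<integral>\<^sup>+t. ennreal (t powr (s - 1) * exp (- t * A)) * indicator {0<..} t \<partial>lborel)"
    using A by (simp add: mult.assoc[symmetric] ennreal_mult[symmetric] powr_diff)
  finally have eq: "ennreal (A powr s) * (\<integral>\<^sup>+t. ennreal (t powr (s - 1) * exp (- t * A)) * indicator {0<..} t \<partial>lborel) = ennreal (Gamma s)" ..
  have "(\<integral>\<^sup>+t. ennreal (t powr (s - 1) * exp (- t * A)) * indicator {0<..} t \<partial>lborel)
     = ennreal (A powr (-s)) * (ennreal (A powr s) * (\<integral>\<^sup>+t. ennreal (t powr (s - 1) * exp (- t * A)) * indicator {0<..} t \<partial>lborel))"
    using A by (simp add: mult.assoc[symmetric] ennreal_mult[symmetric] powr_add[symmetric])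
  then show ?thesis unfolding eq using s by (simp add: ennreal_mult[symmetric] mult.commute Gamma_real_nonneg)
qed

lemma nn_integral_gaussian:
  assumes t: "t > 0"
  shows "(\<integral>\<^sup>+y. ennreal (exp (- t * (c - y)\<^sup>2)) \<partial>lborel) = ennreal (sqrt (pi / t))"
proof -
  have "has_bochner_integral lborel (\<lambda>x. exp (- x\<^sup>2) * x ^ (2 * 0)) (sqrt pi)" 
    using has_bochner_integral_even_function[OF gaussian_moment_even_pos[where k=0]] by simp
  then have "(\<integral>\<^sup>+x. ennreal (exp (- x\<^sup>2)) \<partial>lborel) = ennreal (sqrt pi)"
    by (subst nn_integral_eq_integral) (auto simp: has_bochner_integral_iff)
  also have "(\<integral>\<^sup>+x. ennreal (exp (- x\<^sup>2)) \<partial>lborel) = 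
     ennreal (sqrt t) * (\<integral>\<^sup>+y. ennreal (exp (- (- (sqrt t * c) + sqrt t * y)\<^sup>2)) \<partial>lborel)"
    using t by (subst nn_integral_real_affine[where c = "sqrt t" and t = "- (sqrt t * c)"]) auto
  also have "(\<lambda>y. (- (sqrt t * c) + sqrt t * y)\<^sup>2) = (\<lambda>y. t * (c - y)\<^sup>2)"
  proof
    fix y
    have "(- (sqrt t * c) + sqrt t * y)\<^sup>2 = (sqrt t)\<^sup>2 * (c - y)\<^sup>2" by (simp add: power2_eq_square algebra_simps)
    then show "(- (sqrt t * c) + sqrt t * y)\<^sup>2 = t * (c - y)\<^sup>2" using t by simp
  qed
  finally have eq: "ennreal (sqrt t) * (\<integral>\<^sup>+y. ennreal (exp (- t * (c - y)\<^sup>2)) \<partial>lborel) = ennreal (sqrt pi)" by simp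
  have "(\<integral>\<^sup>+y. ennreal (exp (- t * (c - y)\<^sup>2)) \<partial>lborel) = ennreal (1 / sqrt t) * (ennreal (sqrt t) * (\<integral>\<^sup>+y. ennreal (exp (- t * (c - y)\<^sup>2)) \<partial>lborel))"
    using t by (simp add: mult.assoc[symmetric] ennreal_mult[symmetric])
  then show ?thesis unfolding eq using t by (simp add: ennreal_mult[symmetric] real_sqrt_divide)
qed

text \<open>This is the integral of \<open>(1 + |z|^2) powr (- (d + a) / 2)\<close> over all
  \<open>z\<close> in dimension \<open>d - 1\<close>, and the first factor of
  \<open>kappa\<close>.\<close>

definition slice_const :: "nat \<Rightarrow> real \<Rightarrow> real" where
  "slice_const d a = pi powr ((real d - 1) / 2) * Gamma ((1 + a) / 2) / Gamma ((a + real d) / 2)"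

text \<open>The power of the norm is a Gamma integral of Gaussians in \<open>t\<close>. Each
  coordinate other than \<open>k\<close> integrates to \<open>sqrt (pi / t)\<close>, which lowers
  the power of \<open>t\<close>, and the remaining \<open>t\<close>-integral is again a Gamma
  integral, now for the one-dimensional distance. The range \<open>a > -1\<close> is needed because
  the tangential error is later estimated with a negative exponent.\<close>

lemma nn_integral_norm_powr_slice:
  fixes x :: "real^'n::finite" and G :: "real \<Rightarrow> ennreal"
  assumes a: "a > -1" and [measurable]: "G \<in> borel_measurable borel"
  shows "(\<integral>\<^sup>+y. G (y $ k) * ennreal (norm (x - y) powr (- (real CARD('n) + a))) \<partial>lborel)
     = ennreal (slice_const CARD('n) a) * (\<integral>\<^sup>+t. G t * ennreal (\<bar>x $ k - t\<bar> powr (- (1 + a))) \<partial>lborel)"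
proof -
  define d where "d = CARD('n)"
  define s where "s = (real d + a) / 2"
  have d: "d \<ge> 1" unfolding d_def by (simp add: Suc_leI)
  have s: "s > 0" using d a by (simp add: s_def)
  have s1: "(1 + a) / 2 > 0" using a by simp
  have G_pos: "Gamma s > 0" "Gamma ((1 + a) / 2) > 0" using s s1 by (auto intro: Gamma_real_pos)
  have gauss: "(\<integral>\<^sup>+y. G (y $ k) * ennreal (exp (- t * (norm (x - y))\<^sup>2)) \<partial>lborel)
     = (\<integral>\<^sup>+u. G u * ennreal (exp (- t * (x $ k - u)\<^sup>2)) \<partial>lborel) * ennreal ((pi / t) powr ((real d - 1) / 2))"
    if t: "t > 0" for t
  proof -
    define f where "f i u = (if i = k then G u else 1) * ennreal (exp (- t * (x $ i - u)\<^sup>2))" for i u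
    have [measurable]: "f i \<in> borel_measurable borel" for i unfolding f_def by (cases "i = k") auto
    have "G (y $ k) * ennreal (exp (- t * (norm (x - y))\<^sup>2)) = (\<Prod>i\<in>UNIV. f i (y $ i))" for y
    proof -
      have "(norm (x - y))\<^sup>2 = (\<Sum>i\<in>UNIV. (x $ i - y $ i)\<^sup>2)"
        by (simp add: norm_vec_def L2_set_def sum_nonneg)
      then have "ennreal (exp (- t * (norm (x - y))\<^sup>2)) = (\<Prod>i\<in>UNIV. ennreal (exp (- t * (x $ i - y $ i)\<^sup>2)))"
        by (simp add: prod_ennreal exp_sum[symmetric] sum_distrib_left sum_negf)
      then show ?thesis by (simp add: f_def prod.distrib)
    qed
    then have "(\<integral>\<^sup>+y. G (y $ k) * ennreal (exp (- t * (norm (x - y))\<^sup>2)) \<partial>lborel) = (\<Prod>i\<in>UNIV. \<integral>\<^sup>+u. f i u \<partial>lborel)"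
      by (simp add: nn_integral_vec_prod)
    also have "\<dots> = (\<integral>\<^sup>+u. f k u \<partial>lborel) * (\<Prod>i\<in>UNIV - {k}. \<integral>\<^sup>+u. f i u \<partial>lborel)"
      by (simp add: prod.remove)
    also have "(\<Prod>i\<in>UNIV - {k}. \<integral>\<^sup>+u. f i u \<partial>lborel) = (\<Prod>i\<in>UNIV - {k}. ennreal (sqrt (pi / t)))"
      by (intro prod.cong) (auto simp: f_def nn_integral_gaussian[OF t, simplified])
    also have "\<dots> = ennreal ((pi / t) powr ((real d - 1) / 2))"
    proof -
      have "(\<Prod>i\<in>UNIV - {k}. ennreal (sqrt (pi / t))) = ennreal (sqrt (pi / t) ^ (d - 1))"
        using t by (simp add: d_def ennreal_power card_Diff_singleton)
      also have "sqrt (pi / t) ^ (d - 1) = ((pi / t) powr (1/2)) powr (real (d - 1))"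
        using t by (subst powr_realpow) (auto simp: powr_half_sqrt)
      also have "\<dots> = (pi / t) powr ((real d - 1) / 2)"
        using d by (simp add: powr_powr of_nat_diff)
      finally show ?thesis .
    qed
    finally show ?thesis by (simp add: f_def)
  qed
  \<comment> \<open>Stated for a general exponent since it is used in both directions: with
    \<open>q = s\<close> to open up the norm, and with \<open>q = (1 + a) / 2\<close> to reassemble
    the one-dimensional kernel.\<close>
  have rep: "ennreal (h powr (- (2 * q))) = ennreal (1 / Gamma q) * 
     (\<integral>\<^sup>+t. ennreal (t powr (q - 1) * exp (- t * h\<^sup>2)) * indicator {0<..} t \<partial>lborel)" if "q > 0" "h > 0" for q h
  proof -
    have "(h\<^sup>2) powr (-q) = h powr (- (2 * q))" using that by (simp add: powr_powr flip: powr_numeral)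
    moreover have "Gamma q \<noteq> 0" using Gamma_real_pos[OF that(1)] by linarith
    ultimately show ?thesis
      using that nn_integral_Gamma[of q "h\<^sup>2"] by (simp add: ennreal_mult[symmetric])
  qed
  have "(\<integral>\<^sup>+y. G (y $ k) * ennreal (norm (x - y) powr (- (real d + a))) \<partial>lborel)
    = (\<integral>\<^sup>+y. ennreal (1 / Gamma s) * (\<integral>\<^sup>+t. G (y $ k) * (ennreal (t powr (s - 1) * exp (- t * (norm (x - y))\<^sup>2)) * indicator {0<..} t) \<partial>lborel) \<partial>lborel)"
  proof (rule nn_integral_cong_AE, rule AE_mp[OF AE_lborel_singleton[of x]], rule AE_I2, rule impI)
    fix y assume "y \<noteq> x"
    then have "norm (x - y) > 0" by simp
    have "- (real d + a) = - (2 * s)" by (simp add: s_def field_simps)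
    then have "ennreal (norm (x - y) powr (- (real d + a))) = ennreal (1 / Gamma s) * 
       (\<integral>\<^sup>+t. ennreal (t powr (s - 1) * exp (- t * (norm (x - y))\<^sup>2)) * indicator {0<..} t \<partial>lborel)"
      using rep[OF s \<open>norm (x - y) > 0\<close>] by (simp only:)
    then show "G (y $ k) * ennreal (norm (x - y) powr (- (real d + a))) = 
       ennreal (1 / Gamma s) * (\<integral>\<^sup>+t. G (y $ k) * (ennreal (t powr (s - 1) * exp (- t * (norm (x - y))\<^sup>2)) * indicator {0<..} t) \<partial>lborel)"
      by (subst nn_integral_cmult, measurable) (simp only: mult.left_commute)
  qed
  also have "\<dots> = ennreal (1 / Gamma s) * (\<integral>\<^sup>+y. (\<integral>\<^sup>+t. G (y $ k) * (ennreal (t powr (s - 1) * exp (- t * (norm (x - y))\<^sup>2)) * indicator {0<..} t) \<partial>lborel) \<partial>lborel)"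
    by (intro nn_integral_cmult) measurable
  also have "(\<integral>\<^sup>+y. (\<integral>\<^sup>+t. G (y $ k) * (ennreal (t powr (s - 1) * exp (- t * (norm (x - y))\<^sup>2)) * indicator {0<..} t) \<partial>lborel) \<partial>lborel)
    = (\<integral>\<^sup>+t. (\<integral>\<^sup>+y. G (y $ k) * (ennreal (t powr (s - 1) * exp (- t * (norm (x - y))\<^sup>2)) * indicator {0<..} t) \<partial>lborel) \<partial>lborel)"
    by (rule lborel_pair.Fubini') measurable
  also have "\<dots> = (\<integral>\<^sup>+t. (\<integral>\<^sup>+u. ennreal (pi powr ((real d - 1) / 2)) * (G u * (ennreal (t powr ((1 + a) / 2 - 1) * exp (- t * (x $ k - u)\<^sup>2)) * indicator {0<..} t)) \<partial>lborel) \<partial>lborel)"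
  proof (rule nn_integral_cong)
    fix t :: real
    show "(\<integral>\<^sup>+y. G (y $ k) * (ennreal (t powr (s - 1) * exp (- t * (norm (x - y))\<^sup>2)) * indicator {0<..} t) \<partial>lborel)
       = (\<integral>\<^sup>+u. ennreal (pi powr ((real d - 1) / 2)) * (G u * (ennreal (t powr ((1 + a) / 2 - 1) * exp (- t * (x $ k - u)\<^sup>2)) * indicator {0<..} t)) \<partial>lborel)"
    proof (cases "t > 0")
      case t: True
      have "(\<integral>\<^sup>+y. G (y $ k) * (ennreal (t powr (s - 1) * exp (- t * (norm (x - y))\<^sup>2)) * indicator {0<..} t) \<partial>lborel)
         = (\<integral>\<^sup>+y. ennreal (t powr (s - 1)) * (G (y $ k) * ennreal (exp (- t * (norm (x - y))\<^sup>2))) \<partial>lborel)"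
        using t by (intro nn_integral_cong) (simp add: ennreal_mult mult_ac)
      also have "\<dots> = ennreal (t powr (s - 1)) * ((\<integral>\<^sup>+u. G u * ennreal (exp (- t * (x $ k - u)\<^sup>2)) \<partial>lborel) * ennreal ((pi / t) powr ((real d - 1) / 2)))"
        by (subst nn_integral_cmult) (auto simp: gauss[OF t, simplified])
      also have "\<dots> = ennreal (pi powr ((real d - 1) / 2) * t powr ((1 + a) / 2 - 1)) * (\<integral>\<^sup>+u. G u * ennreal (exp (- t * (x $ k - u)\<^sup>2)) \<partial>lborel)"
      proof -
        have "s - 1 = ((1 + a) / 2 - 1) + (real d - 1) / 2" by (simp add: s_def field_simps)
        then have "t powr (s - 1) * (pi / t) powr ((real d - 1) / 2) = pi powr ((real d - 1) / 2) * t powr ((1 + a) / 2 - 1)"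
          using t by (simp add: powr_divide powr_add)
        then have "ennreal (t powr (s - 1)) * ennreal ((pi / t) powr ((real d - 1) / 2)) = ennreal (pi powr ((real d - 1) / 2) * t powr ((1 + a) / 2 - 1))"
          by (simp add: ennreal_mult[symmetric])
        moreover have "X * (Y * Z) = (X * Z) * Y" for X Y Z :: ennreal by (simp add: mult_ac)
        ultimately show ?thesis by (simp only:)
      qed
      also have "\<dots> = (\<integral>\<^sup>+u. ennreal (pi powr ((real d - 1) / 2)) * (G u * (ennreal (t powr ((1 + a) / 2 - 1) * exp (- t * (x $ k - u)\<^sup>2)) * indicator {0<..} t)) \<partial>lborel)"
        using t by (subst nn_integral_cmult[symmetric], measurable)
          (intro nn_integral_cong, simp add: ennreal_mult mult_ac)
      finally show ?thesis .
    qed simp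
  qed
  also have "\<dots> = (\<integral>\<^sup>+u. (\<integral>\<^sup>+t. ennreal (pi powr ((real d - 1) / 2)) * (G u * (ennreal (t powr ((1 + a) / 2 - 1) * exp (- t * (x $ k - u)\<^sup>2)) * indicator {0<..} t)) \<partial>lborel) \<partial>lborel)"
    by (rule lborel_pair.Fubini') measurable
  also have "\<dots> = (\<integral>\<^sup>+u. ennreal (pi powr ((real d - 1) / 2) * Gamma ((1 + a) / 2)) * (G u * ennreal (\<bar>x $ k - u\<bar> powr (- (1 + a)))) \<partial>lborel)"
  proof (rule nn_integral_cong_AE, rule AE_mp[OF AE_lborel_singleton[of "x $ k"]], rule AE_I2, rule impI)
    fix u assume "u \<noteq> x $ k"
    then have h: "\<bar>x $ k - u\<bar> > 0" by simp
    have "(\<integral>\<^sup>+t. ennreal (pi powr ((real d - 1) / 2)) * (G u * (ennreal (t powr ((1 + a) / 2 - 1) * exp (- t * (x $ k - u)\<^sup>2)) * indicator {0<..} t)) \<partial>lborel)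
       = ennreal (pi powr ((real d - 1) / 2)) * (G u * (\<integral>\<^sup>+t. ennreal (t powr ((1 + a) / 2 - 1) * exp (- t * \<bar>x $ k - u\<bar>\<^sup>2)) * indicator {0<..} t \<partial>lborel))"
      by (simp add: nn_integral_cmult)
    also have "(\<integral>\<^sup>+t. ennreal (t powr ((1 + a) / 2 - 1) * exp (- t * \<bar>x $ k - u\<bar>\<^sup>2)) * indicator {0<..} t \<partial>lborel)
       = ennreal (Gamma ((1 + a) / 2)) * ennreal (\<bar>x $ k - u\<bar> powr (- (1 + a)))"
    proof -
      have "- (1 + a) = - (2 * ((1 + a) / 2))" by (simp add: field_simps)
      then show ?thesis 
        using rep[OF s1 h] G_pos(2)
        by (simp add: mult.assoc[symmetric] ennreal_mult[symmetric])
    qed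
    finally show "(\<integral>\<^sup>+t. ennreal (pi powr ((real d - 1) / 2)) * (G u * (ennreal (t powr ((1 + a) / 2 - 1) * exp (- t * (x $ k - u)\<^sup>2)) * indicator {0<..} t)) \<partial>lborel)
       = ennreal (pi powr ((real d - 1) / 2) * Gamma ((1 + a) / 2)) * (G u * ennreal (\<bar>x $ k - u\<bar> powr (- (1 + a))))"
      using G_pos by (simp add: ennreal_mult mult_ac)
  qed
  also have "\<dots> = ennreal (pi powr ((real d - 1) / 2) * Gamma ((1 + a) / 2)) * (\<integral>\<^sup>+u. G u * ennreal (\<bar>x $ k - u\<bar> powr (- (1 + a))) \<partial>lborel)"
    by (rule nn_integral_cmult) measurable
  also have "ennreal (1 / Gamma s) * \<dots> = ennreal (slice_const d a) * (\<integral>\<^sup>+u. G u * ennreal (\<bar>x $ k - u\<bar> powr (- (1 + a))) \<partial>lborel)"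
    using G_pos by (simp add: mult.assoc[symmetric] ennreal_mult[symmetric] slice_const_def s_def add.commute)
  finally show ?thesis unfolding d_def .
qed

subsection \<open>Logarithmic coordinates\<close>

text \<open>For positive \<open>x\<close>, \<open>y\<close> with \<open>r = ln x - ln y\<close> this
  is \<open>(\<bar>x - y\<bar> / sqrt (x * y)) powr (- (1 + a))\<close>, the dilation-invariant part
  of the one-dimensional kernel.\<close>

definition log_kernel :: "real \<Rightarrow> real \<Rightarrow> real" where
  "log_kernel a r = (2 * sinh (\<bar>r\<bar> / 2)) powr (- (1 + a))"

lemma log_kernel_measurable [measurable]: "log_kernel a \<in> borel_measurable borel"
  unfolding log_kernel_def sinh_field_def by measurable

lemma log_kernel_nonneg [simp]: "0 \<le> log_kernel a r"
  by (simp add: log_kernel_def)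

lemma log_kernel_minus [simp]: "log_kernel a (- r) = log_kernel a r"
  by (simp add: log_kernel_def)

lemma abs_diff_mult_exp:
  fixes x r :: real
  assumes "x > 0"
  shows "\<bar>x - x * exp r\<bar> = x * exp (r / 2) * (2 * sinh (\<bar>r\<bar> / 2))"
proof -
  have e: "exp r = exp (r / 2) * exp (r / 2)" by (simp flip: exp_add)
  have 1: "exp (r / 2) * (2 * sinh (r / 2)) = exp r - 1"
    by (simp add: sinh_field_def e field_simps exp_minus)
  have 2: "\<bar>2 * sinh (r / 2)\<bar> = 2 * sinh (\<bar>r\<bar> / 2)"
    by (cases "r \<ge> 0") auto
  have "x - x * exp r = - (x * (exp r - 1))" by (simp add: algebra_simps)
  then have "\<bar>x - x * exp r\<bar> = \<bar>x\<bar> * \<bar>exp r - 1\<bar>" by (simp only: abs_minus_cancel abs_mult)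
  also have "\<bar>exp r - 1\<bar> = exp (r / 2) * (2 * sinh (\<bar>r\<bar> / 2))"
    unfolding 1[symmetric] abs_mult[of "exp (r / 2)"] 2 by simp
  finally show ?thesis using assms by (simp add: mult.assoc)
qed

text \<open>After \<open>t = x * exp r\<close> the Jacobian \<open>exp r\<close> meets the factor
  \<open>exp (r / 2) powr (- (1 + a))\<close> that was split off the kernel, which leaves
  \<open>exp (- ((a - 1) / 2) * r)\<close>. This asymmetric factor is the origin of the exponent of
  the ground state.\<close>

lemma nn_integral_half_line_log:
  fixes g :: "real \<Rightarrow> ennreal"
  assumes [measurable]: "g \<in> borel_measurable borel" and x: "x > 0"
  shows "(\<integral>\<^sup>+t. g (ln t - ln x) * indicator {0<..} t * ennreal (\<bar>x - t\<bar> powr (- (1 + a))) \<partial>lborel)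
     = ennreal (x powr (- a)) * (\<integral>\<^sup>+r. g r * ennreal (exp (- ((a - 1) / 2) * r) * log_kernel a r) \<partial>lborel)"
proof -
  have "(\<integral>\<^sup>+t. g (ln t - ln x) * indicator {0<..} t * ennreal (\<bar>x - t\<bar> powr (- (1 + a))) \<partial>lborel)
     = (\<integral>\<^sup>+t. (g (ln t - ln x) * ennreal (\<bar>x - t\<bar> powr (- (1 + a)))) * indicator {0<..} t \<partial>lborel)"
    by (simp add: mult_ac)
  also have "\<dots> = (\<integral>\<^sup>+s. g (s - ln x) * ennreal (\<bar>x - exp s\<bar> powr (- (1 + a))) * ennreal (exp s) \<partial>lborel)"
    by (subst nn_integral_exp_subst) auto
  also have "\<dots> = (\<integral>\<^sup>+r. g r * ennreal (\<bar>x - x * exp r\<bar> powr (- (1 + a))) * ennreal (x * exp r) \<partial>lborel)"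
    using x by (subst nn_integral_real_affine[where c = 1 and t = "ln x"]) (auto simp: exp_add)
  also have "\<dots> = (\<integral>\<^sup>+r. ennreal (x powr (- a)) * (g r * ennreal (exp (- ((a - 1) / 2) * r) * log_kernel a r)) \<partial>lborel)"
  proof (rule nn_integral_cong)
    fix r
    have "\<bar>x - x * exp r\<bar> powr (- (1 + a)) = x powr (- (1 + a)) * exp (r / 2) powr (- (1 + a)) * log_kernel a r"
      unfolding abs_diff_mult_exp[OF x] log_kernel_def using x by (simp add: powr_mult)
    also have "\<dots> * (x * exp r) = x powr (- (1 + a)) * x * (exp (r / 2) powr (- (1 + a)) * exp r) * log_kernel a r"
      by (simp only: mult_ac)
    also have "x powr (- (1 + a)) * x = x powr (- a)"
      using x by (simp add: powr_diff powr_minus field_simps)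
    also have "exp (r / 2) powr (- (1 + a)) * exp r = exp (- ((a - 1) / 2) * r)"
      by (simp add: powr_def flip: exp_add) (simp add: field_simps)
    finally have "\<bar>x - x * exp r\<bar> powr (- (1 + a)) * (x * exp r) = x powr (- a) * (exp (- ((a - 1) / 2) * r) * log_kernel a r)"
      by (simp only: mult.assoc)
    then have "ennreal (\<bar>x - x * exp r\<bar> powr (- (1 + a))) * ennreal (x * exp r) = ennreal (x powr (- a)) * ennreal (exp (- ((a - 1) / 2) * r) * log_kernel a r)"
      using x by (subst (1 2) ennreal_mult[symmetric]) auto
    then show "g r * ennreal (\<bar>x - x * exp r\<bar> powr (- (1 + a))) * ennreal (x * exp r)
        = ennreal (x powr (- a)) * (g r * ennreal (exp (- ((a - 1) / 2) * r) * log_kernel a r))"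
      by (simp only: mult.assoc mult.left_commute)
  qed
  also have "\<dots> = ennreal (x powr (- a)) * (\<integral>\<^sup>+r. g r * ennreal (exp (- ((a - 1) / 2) * r) * log_kernel a r) \<partial>lborel)"
    by (rule nn_integral_cmult) measurable
  finally show ?thesis .
qed

lemma nn_integral_half_space_log:
  fixes x :: "real^'n::finite" and g :: "real \<Rightarrow> ennreal"
  assumes [measurable]: "g \<in> borel_measurable borel" and a: "a > -1" and x: "x \<in> half_space k"
  shows "(\<integral>\<^sup>+y\<in>half_space k. g (ln (y $ k) - ln (x $ k)) * ennreal (norm (x - y) powr (- (real CARD('n) + a))) \<partial>lborel)
     = ennreal (slice_const CARD('n) a) * (ennreal ((x $ k) powr (- a)) *
         (\<integral>\<^sup>+r. g r * ennreal (exp (- ((a - 1) / 2) * r) * log_kernel a r) \<partial>lborel))"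
proof -
  have x: "x $ k > 0" using x by (simp add: half_space_def)
  have "(\<integral>\<^sup>+y\<in>half_space k. g (ln (y $ k) - ln (x $ k)) * ennreal (norm (x - y) powr (- (real CARD('n) + a))) \<partial>lborel)
    = (\<integral>\<^sup>+y. (\<lambda>t. g (ln t - ln (x $ k)) * indicator {0<..} t) (y $ k) * ennreal (norm (x - y) powr (- (real CARD('n) + a))) \<partial>lborel)"
    by (intro nn_integral_cong) (auto simp: half_space_def split: split_indicator)
  also have "\<dots> = ennreal (slice_const CARD('n) a) * (\<integral>\<^sup>+t. g (ln t - ln (x $ k)) * indicator {0<..} t * ennreal (\<bar>x $ k - t\<bar> powr (- (1 + a))) \<partial>lborel)"
    by (rule nn_integral_norm_powr_slice[OF a]) measurable
  finally show ?thesis by (simp only: nn_integral_half_line_log[OF assms(1) x])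
qed

lemma nn_integral_even:
  fixes f :: "real \<Rightarrow> ennreal"
  assumes [measurable]: "f \<in> borel_measurable borel" and even: "\<And>r. f (- r) = f r"
  shows "(\<integral>\<^sup>+r. f r \<partial>lborel) = 2 * (\<integral>\<^sup>+r. f r * indicator {0<..} r \<partial>lborel)"
proof -
  have "(\<integral>\<^sup>+r. f r \<partial>lborel) = (\<integral>\<^sup>+r. f r * indicator {0<..} r + f r * indicator {..<0} r \<partial>lborel)"
    by (rule nn_integral_cong_AE, rule AE_mp[OF AE_lborel_singleton[of 0]], rule AE_I2) (auto split: split_indicator)
  also have "\<dots> = (\<integral>\<^sup>+r. f r * indicator {0<..} r \<partial>lborel) + (\<integral>\<^sup>+r. f r * indicator {..<0} r \<partial>lborel)"
    by (rule nn_integral_add) measurable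
  also have "(\<integral>\<^sup>+r. f r * indicator {..<0} r \<partial>lborel) = (\<integral>\<^sup>+r. f r * indicator {0<..} r \<partial>lborel)"
    by (subst nn_integral_real_affine[where c = "-1" and t = 0])
       (auto intro!: nn_integral_cong simp: even split: split_indicator)
  finally show ?thesis by (simp add: mult_2)
qed

text \<open>This is \<open>sinh x >= x\<close>. It serves for negative \<open>a\<close>, where the
  bound is locally integrable at 0.\<close>

lemma log_kernel_le:
  fixes r a :: real
  assumes "r > 0" "a > -1"
  shows "log_kernel a r \<le> r powr (- (1 + a))"
proof -
  have "sinh 0 - 0 \<le> sinh (r / 2) - r / 2"
  proof (rule DERIV_nonneg_imp_nondecreasing[where f = "\<lambda>x. sinh x - x"])
    fix x :: real
    have "((\<lambda>x. sinh x - x) has_real_derivative cosh x - 1) (at x)"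
      by (auto intro!: derivative_eq_intros)
    then show "\<exists>y. ((\<lambda>x. sinh x - x) has_real_derivative y) (at x) \<and> 0 \<le> y"
      using cosh_real_ge_1[of x] by (intro exI[of _ "cosh x - 1"]) simp
  qed (use assms in simp)
  then have "r \<le> 2 * sinh (\<bar>r\<bar> / 2)" using assms by simp
  then show ?thesis unfolding log_kernel_def using assms powr_mono2'[of "- (1 + a)" r "2 * sinh (\<bar>r\<bar> / 2)"] by simp
qed

text \<open>Near 0 the integrand behaves like \<open>r powr (1 - a)\<close>, integrable since
  \<open>a < 2\<close>, and far out the kernel decays exponentially. A single Gamma integrand
  dominates at both ends. The moment controls the tails of the kernel as well as the remainder of
  the trial functions.\<close>

lemma log_kernel_second_moment:
  fixes a :: real
  assumes a: "0 < a" "a < 2"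
  shows "(\<integral>\<^sup>+r. ennreal (r\<^sup>2 * log_kernel a r) \<partial>lborel) < \<top>"
proof -
  have bound: "r\<^sup>2 * log_kernel a r \<le> 1728 * (r powr ((2 - a) - 1) * exp (- r * (1/4)))" if r: "r > 0" for r
  proof -
    \<comment> \<open>The lower bound \<open>r / (1 + r)\<close> is linear at 0 and bounded below at
      infinity, so it loses only a polynomial factor \<open>(1 + r) powr (1 + a)\<close>.\<close>
    have "1 - exp (- r) \<ge> r / (1 + r)"
      using r exp_ge_add_one_self[of r] by (simp add: exp_minus field_simps)
    then have "2 * sinh (r / 2) \<ge> exp (r / 2) * (r / (1 + r))"
    proof -
      have "2 * sinh (r / 2) = exp (r / 2) * (1 - exp (- r))"
        by (simp add: sinh_field_def right_diff_distrib flip: exp_add)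
      moreover have "exp (r / 2) * (r / (1 + r)) \<le> exp (r / 2) * (1 - exp (- r))"
        by (rule mult_left_mono) (use \<open>1 - exp (- r) \<ge> r / (1 + r)\<close> in auto)
      ultimately show ?thesis by linarith
    qed
    then have "log_kernel a r \<le> (exp (r / 2) * (r / (1 + r))) powr (- (1 + a))"
      unfolding log_kernel_def using r a by (intro powr_mono2') auto
    also have "\<dots> = exp (r / 2) powr (- (1 + a)) * r powr (- (1 + a)) * (1 + r) powr (1 + a)"
    proof -
      have "(1 + r) powr (- (1 + a)) = 1 / (1 + r) powr (1 + a)" by (rule powr_minus_divide)
      then show ?thesis using r by (simp only: powr_mult powr_divide) (simp add: powr_mult powr_divide)
    qed
    also have "\<dots> \<le> exp (- r / 2) * r powr (- (1 + a)) * (1728 * exp (r / 4))"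
    proof (intro mult_mono)
      show "exp (r / 2) powr (- (1 + a)) \<le> exp (- r / 2)"
        using r a by (simp add: powr_def mult_left_mono field_simps)
      \<comment> \<open>The polynomial is absorbed into \<open>exp (r / 4)\<close>, half of the
        available decay \<open>exp (- r / 2)\<close>; 1728 is \<open>12 ^ 3\<close>.\<close>
      have "(1 + r) powr (1 + a) \<le> (1 + r) powr 3" using r a by (intro powr_mono) auto
      also have "\<dots> = (1 + r) ^ 3" using r by simp
      also have "\<dots> \<le> (12 * exp (r / 12)) ^ 3"
      proof (rule power_mono)
        show "1 + r \<le> 12 * exp (r / 12)" using exp_ge_add_one_self[of "r / 12"] by linarith
      qed (use r in simp)
      also have "\<dots> = 1728 * exp (r / 4)" 
        using exp_of_nat_mult[of 3 "r / 12"] by (simp add: power_mult_distrib)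
      finally show "(1 + r) powr (1 + a) \<le> 1728 * exp (r / 4)" .
    qed (use r in auto)
    finally have "r\<^sup>2 * log_kernel a r \<le> r\<^sup>2 * (exp (- r / 2) * r powr (- (1 + a)) * (1728 * exp (r / 4)))"
      by (intro mult_left_mono) auto
    also have "\<dots> = 1728 * ((r\<^sup>2 * r powr (- (1 + a))) * (exp (- r / 2) * exp (r / 4)))"
      by (simp only: mult_ac)
    also have "r\<^sup>2 * r powr (- (1 + a)) = r powr ((2 - a) - 1)"
      using r by (simp add: powr_diff powr_minus field_simps power2_eq_square)
    also have "exp (- r / 2) * exp (r / 4) = exp (- r * (1/4))"
      by (simp flip: exp_add)
    finally show ?thesis .
  qed
  have "(\<integral>\<^sup>+r. ennreal (r\<^sup>2 * log_kernel a r) \<partial>lborel) = 2 * (\<integral>\<^sup>+r. ennreal (r\<^sup>2 * log_kernel a r) * indicator {0<..} r \<partial>lborel)"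
    by (rule nn_integral_even) auto
  also have "\<dots> \<le> 2 *
    (\<integral>\<^sup>+r. ennreal 1728 * (ennreal (r powr ((2 - a) - 1) * exp (- r * (1/4))) * indicator {0<..} r) \<partial>lborel)"
  proof (rule mult_left_mono, rule nn_integral_mono)
    fix r :: real
    show "ennreal (r\<^sup>2 * log_kernel a r) * indicator {0<..} r \<le>
      ennreal 1728 * (ennreal (r powr ((2 - a) - 1) * exp (- r * (1/4))) * indicator {0<..} r)"
    proof (cases "r > 0")
      case True
      have "ennreal (r\<^sup>2 * log_kernel a r) \<le> ennreal (1728 * (r powr ((2 - a) - 1) * exp (- r * (1/4))))"
        by (intro ennreal_leI bound True)
      then show ?thesis using True by (simp only: ennreal_mult'' mult_nonneg_nonneg powr_ge_zero exp_ge_zero) simp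
    qed simp
  qed simp
  also have "(\<integral>\<^sup>+r. ennreal 1728 * (ennreal (r powr ((2 - a) - 1) * exp (- r * (1/4))) * indicator {0<..} r) \<partial>lborel)
    = ennreal 1728 * ennreal (Gamma (2 - a) * (1/4) powr (- (2 - a)))"
  proof -
    have *: "2 - a > 0" "1/4 > (0::real)" using a by auto
    show ?thesis by (subst nn_integral_cmult, measurable) (simp only: nn_integral_Gamma[OF *])
  qed
  also have "2 * \<dots> < \<top>"
    by (simp only: ennreal_mult_less_top ennreal_less_top ennreal_numeral[symmetric] simp_thms)
  finally show ?thesis .
qed

subsection \<open>The sharp constant\<close>

text \<open>With \<open>t = exp (- r)\<close> this is the half-line form of the integral of
  \<open>(cosh (p * r) - 1) * log_kernel\<close>. It converges because the square vanishes to second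
  order at 1 and is at worst of order \<open>t powr (\<alpha> - 1)\<close> at 0.\<close>

lemma has_integral_ground_state:
  fixes \<alpha> :: real
  assumes \<alpha>: "0 < \<alpha>" "\<alpha> < 2"
  defines "p \<equiv> (\<alpha> - 1) / 2"
  shows "((\<lambda>t. (1 - t powr p)\<^sup>2 * (1 - t) powr (- 1 - \<alpha>)) has_integral
          ((Beta ((1 + \<alpha>) / 2) ((2 - \<alpha>) / 2) - 2 powr \<alpha>) / (\<alpha> * 2 powr \<alpha>))) {0..1}"
proof -
  define f where "f t = (1 - t powr p)\<^sup>2 * (1 - t) powr (- 1 - \<alpha>)" for t
  define g where "g t = ((2 - \<alpha>) - (p + 2 - \<alpha>) * t powr p) * (1 - t) powr (1 - \<alpha>)" for t
  \<comment> \<open>Expanding the square in \<open>f\<close> gives divergent Beta integrals. Two integrations by parts, with primitives chosen so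
    that the boundary terms vanish for all \<open>\<alpha>\<close>, lead from \<open>f\<close> to \<open>- g / \<alpha>\<close>; \<open>F\<close> collects the two boundary terms.\<close>
  define F where "F t = t / \<alpha> * (1 - t) powr (-\<alpha>) * (1 - t powr p) * (2 - t - t powr p)" for t
  have deriv: "(F has_real_derivative (f t + g t / \<alpha>)) (at t)" if t: "0 < t" "t < 1" for t
  proof -
    define A where "A = t powr p"
    define B where "B = (1 - t) powr (-\<alpha>)"
    have 1: "((\<lambda>t. t powr p) has_real_derivative (p * A / t)) (at t)"
      using t by (auto intro!: derivative_eq_intros simp: A_def powr_diff)
    have 2: "((\<lambda>t. (1 - t) powr (-\<alpha>)) has_real_derivative (\<alpha> * B / (1 - t))) (at t)"
      using t by (auto intro!: derivative_eq_intros simp: B_def powr_diff powr_minus field_simps)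
    have "(F has_real_derivative
        (1 / \<alpha> * B * (1 - A) * (2 - t - A) + t / \<alpha> * (\<alpha> * B / (1 - t)) * (1 - A) * (2 - t - A)
         + t / \<alpha> * B * (- (p * A / t)) * (2 - t - A) + t / \<alpha> * B * (1 - A) * (- 1 - p * A / t))) (at t)"
    proof -
      have 0: "((\<lambda>t. t / \<alpha>) has_real_derivative 1 / \<alpha>) (at t)"
        using \<alpha> by (auto intro!: derivative_eq_intros)
      have 3: "((\<lambda>t. 1 - t powr p) has_real_derivative 0 - p * A / t) (at t)"
        by (intro DERIV_diff 1 DERIV_const)
      have 4: "((\<lambda>t. 2 - t - t powr p) has_real_derivative 0 - 1 - p * A / t) (at t)"
        by (intro DERIV_diff 1 DERIV_const DERIV_ident)
      show ?thesis
        unfolding F_def using DERIV_mult[OF DERIV_mult[OF DERIV_mult[OF 0 2] 3] 4]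
        by (rule DERIV_cong) (simp add: A_def B_def algebra_simps)
    qed
    also have "(1 / \<alpha> * B * (1 - A) * (2 - t - A) + t / \<alpha> * (\<alpha> * B / (1 - t)) * (1 - A) * (2 - t - A)
         + t / \<alpha> * B * (- (p * A / t)) * (2 - t - A) + t / \<alpha> * B * (1 - A) * (- 1 - p * A / t))
       = (1 - A)\<^sup>2 * (B / (1 - t)) + ((2 - \<alpha>) - (p + 2 - \<alpha>) * A) * (B * (1 - t)) / \<alpha>"
      using t \<alpha> by (simp add: p_def divide_simps) (simp add: power2_eq_square algebra_simps)
    also have "B / (1 - t) = (1 - t) powr (- 1 - \<alpha>)"
      using t by (simp add: B_def powr_diff powr_minus field_simps)
    also have "B * (1 - t) = (1 - t) powr (1 - \<alpha>)"
      using t by (simp add: B_def powr_diff powr_minus field_simps)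
    finally show ?thesis by (simp add: f_def g_def A_def)
  qed
  \<comment> \<open>For \<alpha> < 1 the exponent \<open>p\<close> is negative and the factors of
    \<open>F\<close> blow up at 0 one by one. Multiplied out with the factor \<open>t\<close>, only
    the positive exponents \<open>p + 1\<close> and \<open>1 + 2 * p = \<alpha>\<close>
    occur.\<close>
  have cont0: "(F \<longlongrightarrow> F 0) (at 0 within {0..1})"
  proof -
    have pw: "((\<lambda>t::real. t powr c) \<longlongrightarrow> 0 powr c) (at 0 within {0..1})" if "c > 0" for c
      by (rule tendsto_powr') (use that in \<open>auto intro!: tendsto_intros simp: eventually_at_filter\<close>)
    have "((\<lambda>t. (t * (2 - t) - (3 - t) * t powr (p + 1) + t powr \<alpha>) * (1 - t) powr (-\<alpha>) / \<alpha>) \<longlongrightarrow>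
        (0 * (2 - 0) - (3 - 0) * 0 powr (p + 1) + 0 powr \<alpha>) * (1 - 0) powr (-\<alpha>) / \<alpha>) (at 0 within {0..1})"
      using \<alpha> by (intro tendsto_mult tendsto_divide tendsto_diff tendsto_add pw tendsto_const tendsto_ident_at tendsto_powr)
        (auto simp: p_def field_simps)
    moreover have "eventually (\<lambda>t. (t * (2 - t) - (3 - t) * t powr (p + 1) + t powr \<alpha>) * (1 - t) powr (-\<alpha>) / \<alpha> = F t) (at 0 within {0..1})"
      unfolding eventually_at_filter
    proof (rule always_eventually, intro allI impI)
      fix t :: real assume "t \<noteq> 0" "t \<in> {0..1}"
      then have t: "t > 0" by auto
      have "\<alpha> = 1 + p + p" by (simp add: p_def field_simps)
      then have "t powr \<alpha> = t * t powr p * t powr p" using t by (simp only: powr_add) simp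
      moreover have "t powr (p + 1) = t * t powr p" using t by (simp add: powr_add)
      ultimately show "(t * (2 - t) - (3 - t) * t powr (p + 1) + t powr \<alpha>) * (1 - t) powr (-\<alpha>) / \<alpha> = F t"
        by (simp add: F_def algebra_simps)
    qed
    ultimately have "(F \<longlongrightarrow> (0 * (2 - 0) - (3 - 0) * 0 powr (p + 1) + 0 powr \<alpha>) * (1 - 0) powr (-\<alpha>) / \<alpha>) (at 0 within {0..1})"
      by (rule Lim_transform_eventually)
    then show ?thesis by (simp add: F_def)
  qed
  \<comment> \<open>Both \<open>1 - t powr p\<close> and \<open>2 - t - t powr p\<close> vanish to
    first order at 1. Expressed by the difference quotient \<open>q\<close>, they turn
    \<open>(1 - t) powr (- \<alpha>)\<close> into \<open>(1 - t) powr (2 - \<alpha>)\<close>, which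
    tends to 0.\<close>
  have cont1: "(F \<longlongrightarrow> F 1) (at 1 within {0..1})"
  proof -
    define q where "q t = (t powr p - 1) / (t - 1)" for t
    have "((\<lambda>t. t powr p) has_real_derivative p) (at 1)"
      by (auto intro!: derivative_eq_intros)
    then have q: "(q \<longlongrightarrow> p) (at 1 within {0..1})"
      unfolding q_def has_field_derivative_iff powr_one_eq_one by (rule tendsto_within_subset) simp
    have pw: "((\<lambda>t::real. (1 - t) powr (2 - \<alpha>)) \<longlongrightarrow> (1 - 1) powr (2 - \<alpha>)) (at 1 within {0..1})"
      by (rule tendsto_powr') (use \<alpha> in \<open>auto intro!: tendsto_eq_intros simp: eventually_at_filter\<close>)
    have "((\<lambda>t. t / \<alpha> * q t * (1 + q t) * (1 - t) powr (2 - \<alpha>)) \<longlongrightarrow> 1 / \<alpha> * p * (1 + p) * (1 - 1) powr (2 - \<alpha>)) (at 1 within {0..1})"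
      using \<alpha> by (intro tendsto_intros q pw) auto
    moreover have "eventually (\<lambda>t. t / \<alpha> * q t * (1 + q t) * (1 - t) powr (2 - \<alpha>) = F t) (at 1 within {0..1})"
      unfolding eventually_at_filter
    proof (rule always_eventually, intro allI impI)
      fix t :: real assume "t \<noteq> 1" "t \<in> {0..1}"
      then have t: "t < 1" by auto
      have "1 - t powr p = q t * (1 - t)" using t by (simp add: q_def field_simps)
      moreover have "2 - t - t powr p = (1 + q t) * (1 - t)" using t by (simp add: q_def field_simps)
      moreover have "(1 - t) powr (2 - \<alpha>) = (1 - t) powr (-\<alpha>) * (1 - t) * (1 - t)"
        using t by (simp add: powr_diff powr_minus field_simps power2_eq_square)
      ultimately show "t / \<alpha> * q t * (1 + q t) * (1 - t) powr (2 - \<alpha>) = F t"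
        unfolding F_def by simp
    qed
    ultimately have "(F \<longlongrightarrow> 1 / \<alpha> * p * (1 + p) * (1 - 1) powr (2 - \<alpha>)) (at 1 within {0..1})"
      by (rule Lim_transform_eventually)
    then show ?thesis by (simp add: F_def)
  qed
  have "continuous_on {0..1} F"
    unfolding continuous_on_def
  proof
    fix t :: real assume t: "t \<in> {0..1}"
    consider "t = 0" | "t = 1" | "0 < t" "t < 1" using t by fastforce
    then show "(F \<longlongrightarrow> F t) (at t within {0..1})"
    proof cases
      case 3
      then have "isCont F t" using deriv DERIV_isCont by blast
      then show ?thesis unfolding isCont_def by (rule tendsto_within_subset) simp
    qed (use cont0 cont1 in auto)
  qed
  then have "((\<lambda>t. f t + g t / \<alpha>) has_integral (F 1 - F 0)) {0..1}"
    by (intro fundamental_theorem_of_calculus_interior)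
       (auto simp: deriv simp flip: has_real_derivative_iff_has_vector_derivative)
  moreover have "(g has_integral ((2 - \<alpha>) * Beta 1 (2 - \<alpha>) - (p + 2 - \<alpha>) * Beta (p + 1) (2 - \<alpha>))) {0..1}"
  proof -
    have "((\<lambda>t. t powr (1 - 1) * (1 - t) powr (2 - \<alpha> - 1)) has_integral Beta 1 (2 - \<alpha>)) {0..1}"
      using \<alpha> by (intro has_integral_Beta_real) auto
    \<comment> \<open>The point 0 is exempted because \<open>0 powr 0 = 0\<close>, whereas the
      factor \<open>t powr (1 - 1)\<close> is 1 elsewhere.\<close>
    then have "((\<lambda>t. (1 - t) powr (1 - \<alpha>)) has_integral Beta 1 (2 - \<alpha>)) {0..1}"
      by (rule has_integral_spike_finite[of "{0}", rotated 2]) auto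
    moreover have "((\<lambda>t. t powr (p + 1 - 1) * (1 - t) powr (2 - \<alpha> - 1)) has_integral Beta (p + 1) (2 - \<alpha>)) {0..1}"
      using \<alpha> by (intro has_integral_Beta_real) (auto simp: p_def field_simps)
    ultimately have "((\<lambda>t. (2 - \<alpha>) * (1 - t) powr (1 - \<alpha>) - (p + 2 - \<alpha>) * (t powr (p + 1 - 1) * (1 - t) powr (2 - \<alpha> - 1)))
        has_integral ((2 - \<alpha>) * Beta 1 (2 - \<alpha>) - (p + 2 - \<alpha>) * Beta (p + 1) (2 - \<alpha>))) {0..1}"
      by (intro has_integral_diff has_integral_mult_right)
    then show ?thesis unfolding g_def by (simp add: algebra_simps)
  qed
  ultimately have "((\<lambda>t. f t + g t / \<alpha> - g t / \<alpha>) has_integral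
     (F 1 - F 0 - ((2 - \<alpha>) * Beta 1 (2 - \<alpha>) - (p + 2 - \<alpha>) * Beta (p + 1) (2 - \<alpha>)) / \<alpha>)) {0..1}"
    by (intro has_integral_diff has_integral_divide)
  then have f: "(f has_integral (- ((2 - \<alpha>) * Beta 1 (2 - \<alpha>) - (p + 2 - \<alpha>) * Beta (p + 1) (2 - \<alpha>)) / \<alpha>)) {0..1}"
    unfolding minus_divide_left[symmetric] by (simp only: F_def) simp
  have nonpos: "x \<notin> \<int>\<^sub>\<le>\<^sub>0" if "x > 0" for x :: real
    using that by (auto elim!: nonpos_Ints_cases)
  have "Gamma (2 - \<alpha>) > 0" by (rule Gamma_real_pos) (use \<alpha> in simp)
  then have "Gamma (2 - \<alpha>) \<noteq> 0" by linarith
  then have b1: "(2 - \<alpha>) * Beta 1 (2 - \<alpha>) = 1"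
    using \<alpha> Gamma_plus1[OF nonpos[of "2 - \<alpha>"]] by (simp add: Beta_def add.commute)
  \<comment> \<open>Legendre duplication at \<open>z = (2 - \<alpha>) / 2\<close> splits
    \<open>Gamma (2 - \<alpha>)\<close>; one of the two factors cancels and the other completes a
    Beta value, because \<open>(1 + \<alpha>) / 2 + z = 3/2\<close> makes its denominator the known
    \<open>Gamma (3/2)\<close>.\<close>
  have b2: "(p + 2 - \<alpha>) * Beta (p + 1) (2 - \<alpha>) = Beta ((1 + \<alpha>) / 2) ((2 - \<alpha>) / 2) / 2 powr \<alpha>"
  proof -
    define z where "z = (2 - \<alpha>) / 2"
    have z: "z > 0" using \<alpha> by (simp add: z_def)
    have dup: "Gamma z * Gamma (z + 1/2) = 2 powr (1 - 2 * z) * sqrt pi * Gamma (2 * z)"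
    proof -
      have "complex_of_real z \<notin> \<int>\<^sub>\<le>\<^sub>0" "complex_of_real z + 1/2 \<notin> \<int>\<^sub>\<le>\<^sub>0"
        using nonpos[OF z] nonpos[of "z + 1/2"] z of_real_in_nonpos_Ints_iff[of "z + 1/2", where ?'a = complex]
          of_real_in_nonpos_Ints_iff[of z, where ?'a = complex] by auto
      from Gamma_legendre_duplication[OF this]
      have "complex_of_real (Gamma z * Gamma (z + 1/2)) = complex_of_real (exp ((1 - 2 * z) * ln 2) * sqrt pi * Gamma (2 * z))"
        by (simp add: Gamma_complex_of_real[symmetric] exp_of_real[symmetric])
      then show ?thesis by (simp only: of_real_eq_iff) (simp add: powr_def)
    qed
    have G32: "Gamma (3/2 :: real) = sqrt pi / 2"
      using Gamma_plus1[OF nonpos[of "1/2"]] by (simp add: Gamma_one_half_real)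
    have G1: "Gamma (z + 3/2) = (z + 1/2) * Gamma (z + 1/2)"
      using Gamma_plus1[OF nonpos[of "z + 1/2"]] z by (simp add: add.assoc)
    have pos: "Gamma (z + 1/2) > 0" using z by (auto intro!: Gamma_real_pos)
    have eqs: "p + 2 - \<alpha> = z + 1/2" "p + 1 + (2 - \<alpha>) = z + 3/2" "(2 - \<alpha>) / 2 = z" "2 - \<alpha> = 2 * z" "p + 1 = (1 + \<alpha>) / 2" "(1 + \<alpha>) / 2 + z = 3/2"
      by (auto simp: z_def p_def field_simps)
    have "2 powr (1 - 2 * z) * 2 powr (1 - \<alpha>) = (1::real)"
      by (simp add: z_def powr_add[symmetric] field_simps)
    then have pw: "1 / 2 powr (1 - 2 * z) = (2::real) / 2 powr \<alpha>"
      by (simp add: powr_diff field_simps)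
    have "(z + 1/2) * Beta ((1 + \<alpha>) / 2) (2 * z) = Gamma ((1 + \<alpha>) / 2) * Gamma (2 * z) / Gamma (z + 1/2)"
    proof -
      have "(1 + \<alpha>) / 2 + 2 * z = z + 3/2" using eqs(6) by linarith
      then show ?thesis using z pos unfolding Beta_def by (simp only: G1) simp
    qed
    also have "Gamma (2 * z) = Gamma z * Gamma (z + 1/2) / sqrt pi * (1 / 2 powr (1 - 2 * z))"
      unfolding dup by simp
    also have "Gamma ((1 + \<alpha>) / 2) * \<dots> / Gamma (z + 1/2) = Beta ((1 + \<alpha>) / 2) z / 2 powr \<alpha>"
      using pos unfolding pw Beta_def eqs(6) G32 by simp
    finally show ?thesis unfolding eqs(1,3) unfolding eqs(4,5) .
  qed
  have "- ((2 - \<alpha>) * Beta 1 (2 - \<alpha>) - (p + 2 - \<alpha>) * Beta (p + 1) (2 - \<alpha>)) / \<alpha> = 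
     (Beta ((1 + \<alpha>) / 2) ((2 - \<alpha>) / 2) - 2 powr \<alpha>) / (\<alpha> * 2 powr \<alpha>)"
    unfolding b1 b2 using \<alpha> by (simp add: field_simps)
  with f show ?thesis unfolding f_def by simp
qed

text \<open>The factor 2 from evenness turns \<open>cosh (p * r) - 1\<close> into
  \<open>exp (p * r) * (1 - exp (- (p * r)))^2 / 2\<close> times 2, a perfect square in
  \<open>t = exp (- r)\<close>. The leftover exponentials combine to \<open>exp (- r)\<close>, which
  is the Jacobian.\<close>

lemma nn_integral_ground_state:
  fixes a :: real
  assumes a: "0 < a" "a < 2"
  shows "(\<integral>\<^sup>+r. ennreal ((cosh ((a - 1) / 2 * r) - 1) * log_kernel a r) \<partial>lborel)
     = ennreal ((Beta ((1 + a) / 2) ((2 - a) / 2) - 2 powr a) / (a * 2 powr a))"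
proof -
  define p where "p = (a - 1) / 2"
  define f where "f t = (1 - t powr p)\<^sup>2 * (1 - t) powr (- 1 - a)" for t
  have f_meas [measurable]: "f \<in> borel_measurable borel" unfolding f_def by measurable
  have cosh_meas [measurable]: "(\<lambda>r. cosh (p * r)) \<in> borel_measurable borel"
    unfolding cosh_field_def by measurable
  have eq: "2 * ((cosh (p * r) - 1) * log_kernel a r) = f (exp (- r)) * exp (- r)" if r: "r > 0" for r
  proof -
    have e: "exp (p * r) * exp (- (p * r)) = 1" by (simp flip: exp_add)
    have "2 * (cosh (p * r) - 1) = exp (p * r) + exp (- (p * r)) - 2"
      by (simp add: cosh_field_def)
    also have "\<dots> = exp (p * r) * (1 - exp (- (p * r)))\<^sup>2"
      using e by (simp add: power2_eq_square algebra_simps)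
    finally have 1: "2 * (cosh (p * r) - 1) = exp (p * r) * (1 - exp (- (p * r)))\<^sup>2" .
    have "2 * sinh (\<bar>r\<bar> / 2) = exp (r / 2) * (1 - exp (- r))"
      using r by (simp add: sinh_field_def right_diff_distrib flip: exp_add)
    then have 2: "log_kernel a r = exp (r / 2) powr (- (1 + a)) * (1 - exp (- r)) powr (- (1 + a))"
      unfolding log_kernel_def using r by (simp add: powr_mult)
    have 3: "exp (p * r) * exp (r / 2) powr (- (1 + a)) = exp (- r)"
      by (simp add: powr_def p_def flip: exp_add) (simp add: field_simps)
    have "2 * ((cosh (p * r) - 1) * log_kernel a r) = (2 * (cosh (p * r) - 1)) * log_kernel a r" by simp
    also have "\<dots> = (1 - exp (- (p * r)))\<^sup>2 * (1 - exp (- r)) powr (- (1 + a)) * (exp (p * r) * exp (r / 2) powr (- (1 + a)))"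
      unfolding 1 2 by (simp only: mult_ac)
    also have "\<dots> = f (exp (- r)) * exp (- r)"
      unfolding 3 f_def by (simp add: powr_def)
    finally show ?thesis .
  qed
  have "(\<integral>\<^sup>+r. ennreal ((cosh (p * r) - 1) * log_kernel a r) \<partial>lborel)
     = 2 * (\<integral>\<^sup>+r. ennreal ((cosh (p * r) - 1) * log_kernel a r) * indicator {0<..} r \<partial>lborel)"
    by (rule nn_integral_even) auto
  also have "\<dots> = (\<integral>\<^sup>+r. 2 * (ennreal ((cosh (p * r) - 1) * log_kernel a r) * indicator {0<..} r) \<partial>lborel)"
    by (rule nn_integral_cmult[symmetric]) measurable
  also have "\<dots> = (\<integral>\<^sup>+r. ennreal (f (exp (- r))) * ennreal (exp (- r)) * indicator {..<1} (exp (- r)) \<partial>lborel)"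
  proof (rule nn_integral_cong_AE, rule AE_mp[OF AE_lborel_singleton[of 0]], rule AE_I2, rule impI)
    fix r :: real assume "r \<noteq> 0"
    show "2 * (ennreal ((cosh (p * r) - 1) * log_kernel a r) * indicator {0<..} r) = ennreal (f (exp (- r))) * ennreal (exp (- r)) * indicator {..<1} (exp (- r))"
    proof (cases "r > 0")
      case True
      have "f (exp (- r)) \<ge> 0" by (simp add: f_def)
      moreover have "cosh (p * r) - 1 \<ge> 0" using cosh_real_ge_1[of "p * r"] by simp
      moreover have "2 * ennreal ((cosh (p * r) - 1) * log_kernel a r) = ennreal 2 * ennreal ((cosh (p * r) - 1) * log_kernel a r)"
        by simp
      ultimately show ?thesis using True eq[OF True] by (simp del: ennreal_numeral flip: ennreal_mult)
    next
      case False
      then show ?thesis by simp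
    qed
  qed
  also have "\<dots> = (\<integral>\<^sup>+r. ennreal (f (exp r)) * indicator {..<1} (exp r) * ennreal (exp r) \<partial>lborel)"
    by (subst nn_integral_real_affine[where c = "-1" and t = 0]) (auto simp: mult_ac)
  also have "\<dots> = (\<integral>\<^sup>+t. ennreal (f t) * indicator {..<1} t * indicator {0<..} t \<partial>lborel)"
    by (subst nn_integral_exp_subst) auto
  also have "\<dots> = (\<integral>\<^sup>+t. ennreal (indicator {0..1} t * f t) \<partial>lborel)"
    by (rule nn_integral_cong_AE, rule AE_mp[OF AE_lborel_singleton[of 0]], rule AE_I2)
       (auto simp: f_def split: split_indicator)
  also have "\<dots> = ennreal ((Beta ((1 + a) / 2) ((2 - a) / 2) - 2 powr a) / (a * 2 powr a))"
    using has_integral_ground_state[OF a] unfolding f_def p_def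
    by (intro nn_integral_has_integral_lebesgue) auto
  finally show ?thesis unfolding p_def .
qed

section \<open>Double integrals over the half space\<close>

lemma half_space_measurable [measurable]: "half_space k \<in> sets borel"
  unfolding half_space_def by measurable

text \<open>The inner integration is over the first component, as in \<open>energy\<close>. Taking
  the integrand as a function of a pair lets joint measurability and the exchange of the variables
  be handled once for all densities.\<close>

definition dint :: "'n::finite \<Rightarrow> ((real^'n) \<times> (real^'n) \<Rightarrow> ennreal) \<Rightarrow> ennreal" where
  "dint k F = (\<integral>\<^sup>+y\<in>half_space k. (\<integral>\<^sup>+x\<in>half_space k. F (x, y) \<partial>lborel) \<partial>lborel)"

lemma dint_mono:
  "(\<And>x y. x \<in> half_space k \<Longrightarrow> y \<in> half_space k \<Longrightarrow> F (x, y) \<le> G (x, y)) \<Longrightarrow> dint k F \<le> dint k G"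
  unfolding dint_def by (auto intro!: nn_integral_mono split: split_indicator)

lemma dint_cong:
  "(\<And>x y. x \<in> half_space k \<Longrightarrow> y \<in> half_space k \<Longrightarrow> F (x, y) = G (x, y)) \<Longrightarrow> dint k F = dint k G"
  by (intro antisym dint_mono) simp_all

lemma dint_add:
  assumes [measurable]: "F \<in> borel_measurable (borel \<Otimes>\<^sub>M borel)" "G \<in> borel_measurable (borel \<Otimes>\<^sub>M borel)"
  shows "dint k (\<lambda>z. F z + G z) = dint k F + dint k G"
  unfolding dint_def by (simp add: distrib_right nn_integral_add)

lemma dint_cmult:
  assumes [measurable]: "F \<in> borel_measurable (borel \<Otimes>\<^sub>M borel)"
  shows "dint k (\<lambda>z. c * F z) = c * dint k F"
  unfolding dint_def by (simp add: mult.assoc nn_integral_cmult)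

lemma dint_swap:
  assumes [measurable]: "F \<in> borel_measurable (borel \<Otimes>\<^sub>M borel)"
  shows "dint k F = dint k (\<lambda>(x, y). F (y, x))"
proof -
  have "dint k F = (\<integral>\<^sup>+y. (\<integral>\<^sup>+x. F (x, y) * indicator (half_space k) x * indicator (half_space k) y \<partial>lborel) \<partial>lborel)"
    unfolding dint_def by (simp add: nn_integral_multc)
  also have "\<dots> = (\<integral>\<^sup>+x. (\<integral>\<^sup>+y. F (x, y) * indicator (half_space k) x * indicator (half_space k) y \<partial>lborel) \<partial>lborel)"
    by (rule lborel_pair.Fubini') measurable
  also have "\<dots> = (\<integral>\<^sup>+x. (\<integral>\<^sup>+y. F (x, y) * indicator (half_space k) y * indicator (half_space k) x \<partial>lborel) \<partial>lborel)"
    by (simp only: mult_ac)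
  also have "\<dots> = dint k (\<lambda>(x, y). F (y, x))"
    unfolding dint_def by (simp add: nn_integral_multc)
  finally show ?thesis .
qed

lemma dint_symmetrize:
  assumes [measurable]: "F \<in> borel_measurable (borel \<Otimes>\<^sub>M borel)"
  shows "dint k (\<lambda>z. F z + (\<lambda>(x, y). F (y, x)) z) = 2 * dint k F"
  by (subst dint_add) (auto simp: mult_2 dint_swap[symmetric])

text \<open>The integrand may depend on \<open>y\<close> in any way, but sees \<open>x\<close> only
  through its height relative to \<open>y\<close> and through the kernel, so the inner integral
  reduces to logarithmic coordinates. All later double integrals are evaluated in this way.\<close>

lemma dint_log:
  fixes \<Phi> :: "(real^'n::finite) \<times> real \<Rightarrow> ennreal"
  assumes [measurable]: "\<Phi> \<in> borel_measurable (borel \<Otimes>\<^sub>M borel)" and a: "a > -1"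
  shows "dint k (\<lambda>(x, y). \<Phi> (y, ln (x $ k) - ln (y $ k)) * ennreal (norm (x - y) powr (- (real CARD('n) + a))))
    = ennreal (slice_const CARD('n) a) * (\<integral>\<^sup>+y\<in>half_space k. ennreal ((y $ k) powr (- a)) *
         (\<integral>\<^sup>+r. \<Phi> (y, r) * ennreal (exp (- ((a - 1) / 2) * r) * log_kernel a r) \<partial>lborel) \<partial>lborel)"
proof -
  have "dint k (\<lambda>(x, y). \<Phi> (y, ln (x $ k) - ln (y $ k)) * ennreal (norm (x - y) powr (- (real CARD('n) + a))))
    = (\<integral>\<^sup>+y. ennreal (slice_const CARD('n) a) * (ennreal ((y $ k) powr (- a)) *
         (\<integral>\<^sup>+r. \<Phi> (y, r) * ennreal (exp (- ((a - 1) / 2) * r) * log_kernel a r) \<partial>lborel) * indicator (half_space k) y) \<partial>lborel)"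
    unfolding dint_def
  proof (rule nn_integral_cong)
    fix y :: "real^'n"
    show "(\<integral>\<^sup>+x\<in>half_space k. (case (x, y) of (x, y) \<Rightarrow> \<Phi> (y, ln (x $ k) - ln (y $ k)) * ennreal (norm (x - y) powr (- (real CARD('n) + a)))) \<partial>lborel) * indicator (half_space k) y
      = ennreal (slice_const CARD('n) a) * (ennreal ((y $ k) powr (- a)) *
         (\<integral>\<^sup>+r. \<Phi> (y, r) * ennreal (exp (- ((a - 1) / 2) * r) * log_kernel a r) \<partial>lborel) * indicator (half_space k) y)"
    proof (cases "y \<in> half_space k")
      case True
      have "(\<lambda>r. \<Phi> (y, r)) \<in> borel_measurable borel" by measurable
      from nn_integral_half_space_log[OF this a True] True show ?thesis
        by (simp add: norm_minus_commute)
    qed simp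
  qed
  also have "\<dots> = ennreal (slice_const CARD('n) a) * (\<integral>\<^sup>+y\<in>half_space k. ennreal ((y $ k) powr (- a)) *
         (\<integral>\<^sup>+r. \<Phi> (y, r) * ennreal (exp (- ((a - 1) / 2) * r) * log_kernel a r) \<partial>lborel) \<partial>lborel)"
    by (rule nn_integral_cmult) measurable
  finally show ?thesis .
qed

subsection \<open>Ground state representation\<close>

lemma cosh_measurable_real [measurable (raw)]:
  fixes f :: "'a \<Rightarrow> real"
  assumes [measurable]: "f \<in> borel_measurable M"
  shows "(\<lambda>x. cosh (f x)) \<in> borel_measurable M"
  unfolding cosh_field_def by measurable

text \<open>Dilation invariance at work: the \<open>r\<close>-integral does not depend on
  \<open>y\<close>, and what is left is \<open>(f y)^2\<close> with the weight
  \<open>(y $ k) powr (- a)\<close>.\<close>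

lemma dint_log_separated:
  fixes f :: "real^'n::finite \<Rightarrow> real" and g :: "real \<Rightarrow> ennreal"
  assumes [measurable]: "f \<in> borel_measurable borel" "g \<in> borel_measurable borel"
    and a: "a > -1"
  shows "dint k (\<lambda>(x, y). ennreal ((f y)\<^sup>2) * g (ln (x $ k) - ln (y $ k)) * ennreal (norm (x - y) powr (- (real CARD('n) + a))))
    = ennreal (slice_const CARD('n) a) * (hardy_integral a k f * (\<integral>\<^sup>+r. g r * ennreal (exp (- ((a - 1) / 2) * r) * log_kernel a r) \<partial>lborel))"
proof -
  define I where "I = (\<integral>\<^sup>+r. g r * ennreal (exp (- ((a - 1) / 2) * r) * log_kernel a r) \<partial>lborel)"
  have "dint k (\<lambda>(x, y). ennreal ((f y)\<^sup>2) * g (ln (x $ k) - ln (y $ k)) * ennreal (norm (x - y) powr (- (real CARD('n) + a))))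
    = ennreal (slice_const CARD('n) a) * (\<integral>\<^sup>+y\<in>half_space k. ennreal ((y $ k) powr (- a)) *
         (\<integral>\<^sup>+r. ennreal ((f y)\<^sup>2) * g r * ennreal (exp (- ((a - 1) / 2) * r) * log_kernel a r) \<partial>lborel) \<partial>lborel)"
    using dint_log[of "\<lambda>(y, r). ennreal ((f y)\<^sup>2) * g r" a k] a by simp
  also have "(\<integral>\<^sup>+y\<in>half_space k. ennreal ((y $ k) powr (- a)) *
         (\<integral>\<^sup>+r. ennreal ((f y)\<^sup>2) * g r * ennreal (exp (- ((a - 1) / 2) * r) * log_kernel a r) \<partial>lborel) \<partial>lborel)
      = (\<integral>\<^sup>+y. (ennreal ((f y)\<^sup>2 * (y $ k) powr (- a)) * indicator (half_space k) y) * I \<partial>lborel)"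
  proof (rule nn_integral_cong)
    fix y
    have "(\<integral>\<^sup>+r. ennreal ((f y)\<^sup>2) * g r * ennreal (exp (- ((a - 1) / 2) * r) * log_kernel a r) \<partial>lborel) = ennreal ((f y)\<^sup>2) * I"
      unfolding I_def mult.assoc by (rule nn_integral_cmult) measurable
    then show "ennreal ((y $ k) powr (- a)) *
         (\<integral>\<^sup>+r. ennreal ((f y)\<^sup>2) * g r * ennreal (exp (- ((a - 1) / 2) * r) * log_kernel a r) \<partial>lborel) * indicator (half_space k) y
      = (ennreal ((f y)\<^sup>2 * (y $ k) powr (- a)) * indicator (half_space k) y) * I"
      by (simp add: ennreal_mult mult_ac)
  qed
  also have "\<dots> = hardy_integral a k f * I"
    unfolding hardy_integral_def by (rule nn_integral_multc) measurable
  finally show ?thesis unfolding I_def .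
qed

definition energy_density :: "real \<Rightarrow> (real^'n::finite \<Rightarrow> real) \<Rightarrow> (real^'n) \<times> (real^'n) \<Rightarrow> ennreal" where
  "energy_density a u = (\<lambda>(x, y). ennreal ((u x - u y)\<^sup>2 * norm (x - y) powr (- (real CARD('n) + a))))"

definition ground_density :: "real \<Rightarrow> 'n \<Rightarrow> (real^'n::finite \<Rightarrow> real) \<Rightarrow> (real^'n) \<times> (real^'n) \<Rightarrow> ennreal" where
  "ground_density a k v = (\<lambda>(x, y). ennreal ((x $ k) powr ((a - 1) / 2) * (y $ k) powr ((a - 1) / 2) * (v x - v y)\<^sup>2 *
      norm (x - y) powr (- (real CARD('n) + a))))"

definition far :: "real \<Rightarrow> 'n \<Rightarrow> (real^'n::finite) \<times> (real^'n) \<Rightarrow> ennreal" where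
  "far \<delta> k = (\<lambda>(x, y). indicator {r. \<delta> < \<bar>r\<bar>} (ln (x $ k) - ln (y $ k)))"

definition ground_const :: "real \<Rightarrow> real \<Rightarrow> ennreal" where
  "ground_const a \<delta> = (\<integral>\<^sup>+r. ennreal ((cosh ((a - 1) / 2 * r) - 1) * log_kernel a r) * indicator {r. \<delta> < \<bar>r\<bar>} r \<partial>lborel)"

lemma far_measurable [measurable]: "far \<delta> k \<in> borel_measurable (borel \<Otimes>\<^sub>M borel)"
  unfolding far_def by measurable

lemma energy_density_measurable [measurable]:
  assumes [measurable]: "u \<in> borel_measurable borel"
  shows "energy_density a u \<in> borel_measurable (borel \<Otimes>\<^sub>M borel)"
  unfolding energy_density_def by measurable

lemma ground_density_measurable [measurable]:
  assumes [measurable]: "v \<in> borel_measurable borel"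
  shows "ground_density a k v \<in> borel_measurable (borel \<Otimes>\<^sub>M borel)"
  unfolding ground_density_def by measurable

lemma energy_eq_dint: "energy a (half_space k) u = 1/2 * dint k (energy_density a u)"
  unfolding energy_def dint_def energy_density_def powr_minus_divide by simp

text \<open>Chebyshev's argument with the second moment: on the truncated range
  \<open>1 \<le> r^2 / \<delta>^2\<close>.\<close>

lemma log_kernel_tail:
  fixes a \<delta> :: real
  assumes a: "0 < a" "a < 2" and \<delta>: "\<delta> > 0"
  shows "(\<integral>\<^sup>+r. indicator {r. \<delta> < \<bar>r\<bar>} r * ennreal (log_kernel a r) \<partial>lborel) < \<top>"
proof -
  have "(\<integral>\<^sup>+r. indicator {r. \<delta> < \<bar>r\<bar>} r * ennreal (log_kernel a r) \<partial>lborel) \<le> (\<integral>\<^sup>+r. ennreal (1 / \<delta>\<^sup>2) * ennreal (r\<^sup>2 * log_kernel a r) \<partial>lborel)"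
  proof (rule nn_integral_mono)
    fix r
    have "log_kernel a r \<le> 1 / \<delta>\<^sup>2 * (r\<^sup>2 * log_kernel a r)" if "\<delta> < \<bar>r\<bar>"
    proof -
      have "\<delta>\<^sup>2 \<le> r\<^sup>2" using that \<delta> by (simp flip: abs_le_square_iff)
      then have "\<delta>\<^sup>2 * log_kernel a r \<le> r\<^sup>2 * log_kernel a r" by (intro mult_right_mono) auto
      then show ?thesis using \<delta> by (simp add: field_simps)
    qed
    then show "indicator {r. \<delta> < \<bar>r\<bar>} r * ennreal (log_kernel a r) \<le> ennreal (1 / \<delta>\<^sup>2) * ennreal (r\<^sup>2 * log_kernel a r)"
      by (auto split: split_indicator simp flip: ennreal_mult intro!: ennreal_leI)
  qed
  also have "\<dots> = ennreal (1 / \<delta>\<^sup>2) * (\<integral>\<^sup>+r. ennreal (r\<^sup>2 * log_kernel a r) \<partial>lborel)"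
    by (rule nn_integral_cmult) measurable
  also have "\<dots> < \<top>"
    using log_kernel_second_moment[OF a] by (simp add: ennreal_mult_less_top)
  finally show ?thesis .
qed

text \<open>
  To stay within \<open>[0, \<infinity>]\<close> the two negative terms of the ground state identity are moved to the other
  side. The cut-off makes their integral \<open>2 C h P\<close> finite, so that it can be cancelled at the end.
\<close>

lemma ground_state_representation_far:
  fixes u :: "real^'n::finite \<Rightarrow> real"
  assumes a: "0 < a" "a < 2" and \<delta>: "\<delta> > 0"
    and u [measurable]: "u \<in> borel_measurable borel" and h: "hardy_integral a k u < \<top>"
  shows "dint k (\<lambda>z. energy_density a u z * far \<delta> k z)
    = 2 * (ennreal (slice_const CARD('n) a) * (hardy_integral a k u * ground_const a \<delta>))
      + dint k (\<lambda>z. ground_density a k (\<lambda>x. u x / (x $ k) powr ((a - 1) / 2)) z * far \<delta> k z)"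
proof -
  define p where "p = (a - 1) / 2"
  define C where "C = ennreal (slice_const CARD('n) a)"
  define h where "h = hardy_integral a k u"
  define D where "D = {r::real. \<delta> < \<bar>r\<bar>}"
  have D [measurable]: "D \<in> sets borel" unfolding D_def by measurable
  define P where "P = (\<integral>\<^sup>+r. indicator D r * ennreal (log_kernel a r) \<partial>lborel)"
  define Q where "Q = (\<integral>\<^sup>+r. indicator D r * ennreal (exp (- p * r) * log_kernel a r) \<partial>lborel)"
  define \<Gamma> where "\<Gamma> = ground_const a \<delta>"
  define v where "v x = u x / (x $ k) powr p" for x
  have [measurable]: "v \<in> borel_measurable borel" unfolding v_def by measurable
  \<comment> \<open>\<open>FP\<close> is the term \<open>u(y)^2 * w(x) / w(y)\<close> and
    \<open>FQ\<close> is \<open>u(y)^2\<close>, both with cut-off and kernel. The ratio of weights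
    in \<open>FP\<close> removes the asymmetric exponential, which survives in \<open>FQ\<close>;
    hence the constants \<open>P\<close> and \<open>Q\<close>.\<close>
  define FP where "FP = (\<lambda>(x, y). ennreal ((u y)\<^sup>2) * (indicator D (ln (x $ k) - ln (y $ k)) * ennreal (exp (p * (ln (x $ k) - ln (y $ k))))) * ennreal (norm (x - y) powr (- (real CARD('n) + a))))"
  define FQ where "FQ = (\<lambda>(x, y). ennreal ((u y)\<^sup>2) * indicator D (ln (x $ k) - ln (y $ k)) * ennreal (norm (x - y) powr (- (real CARD('n) + a))))"
  have [measurable]: "FP \<in> borel_measurable (borel \<Otimes>\<^sub>M borel)" "FQ \<in> borel_measurable (borel \<Otimes>\<^sub>M borel)"
    unfolding FP_def FQ_def by measurable
  have FP: "dint k FP = C * (h * P)"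
  proof -
    have "dint k FP = C * (h * (\<integral>\<^sup>+r. (indicator D r * ennreal (exp (p * r))) * ennreal (exp (- ((a - 1) / 2) * r) * log_kernel a r) \<partial>lborel))"
      unfolding FP_def C_def h_def using a by (intro dint_log_separated) auto
    also have "(\<lambda>r. (indicator D r * ennreal (exp (p * r))) * ennreal (exp (- ((a - 1) / 2) * r) * log_kernel a r)) = (\<lambda>r. indicator D r * ennreal (log_kernel a r))"
    proof
      fix r
      have "exp (p * r) * (exp (- ((a - 1) / 2) * r) * log_kernel a r) = log_kernel a r"
        by (simp add: p_def mult.assoc[symmetric] flip: exp_add)
      then have "ennreal (exp (p * r)) * ennreal (exp (- ((a - 1) / 2) * r) * log_kernel a r) = ennreal (log_kernel a r)"
        by (subst ennreal_mult[symmetric]) (simp_all only: mult_nonneg_nonneg exp_ge_zero log_kernel_nonneg)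
      then show "(indicator D r * ennreal (exp (p * r))) * ennreal (exp (- ((a - 1) / 2) * r) * log_kernel a r) = indicator D r * ennreal (log_kernel a r)"
        by (simp only: mult.assoc)
    qed
    finally show ?thesis unfolding P_def .
  qed
  have FQ: "dint k FQ = C * (h * Q)"
    unfolding FQ_def C_def h_def Q_def p_def using a by (intro dint_log_separated) auto
  \<comment> \<open>The reflection \<open>r \<mapsto> - r\<close> turns \<open>exp (- p r)\<close> into \<open>cosh (p r)\<close>.\<close>
  have PQ: "2 * Q = 2 * P + 2 * \<Gamma>"
  proof -
    have "Q = (\<integral>\<^sup>+r. indicator D r * ennreal (exp (p * r) * log_kernel a r) \<partial>lborel)"
      unfolding Q_def by (subst nn_integral_real_affine[where c = "-1" and t = 0]) (auto simp: D_def indicator_def)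
    then have "2 * Q = Q + (\<integral>\<^sup>+r. indicator D r * ennreal (exp (p * r) * log_kernel a r) \<partial>lborel)"
      by (simp add: mult_2)
    also have "\<dots> = (\<integral>\<^sup>+r. indicator D r * ennreal (exp (- p * r) * log_kernel a r) + indicator D r * ennreal (exp (p * r) * log_kernel a r) \<partial>lborel)"
      unfolding Q_def by (rule nn_integral_add[symmetric]) measurable
    also have "\<dots> = (\<integral>\<^sup>+r. 2 * (indicator D r * ennreal (log_kernel a r)) + 2 * (ennreal ((cosh (p * r) - 1) * log_kernel a r) * indicator D r) \<partial>lborel)"
    proof (rule nn_integral_cong)
      fix r
      have "exp (- p * r) * log_kernel a r + exp (p * r) * log_kernel a r = 2 * log_kernel a r + 2 * ((cosh (p * r) - 1) * log_kernel a r)"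
        by (simp add: cosh_field_def algebra_simps)
      moreover have "cosh (p * r) - 1 \<ge> 0" using cosh_real_ge_1[of "p * r"] by simp
      ultimately have "ennreal (exp (- p * r) * log_kernel a r) + ennreal (exp (p * r) * log_kernel a r) = 2 * ennreal (log_kernel a r) + 2 * ennreal ((cosh (p * r) - 1) * log_kernel a r)"
        by (simp del: ennreal_plus ennreal_numeral flip: ennreal_plus ennreal_mult ennreal_numeral)
      then show "indicator D r * ennreal (exp (- p * r) * log_kernel a r) + indicator D r * ennreal (exp (p * r) * log_kernel a r)
         = 2 * (indicator D r * ennreal (log_kernel a r)) + 2 * (ennreal ((cosh (p * r) - 1) * log_kernel a r) * indicator D r)"
        by (cases "r \<in> D") auto
    qed
    also have "\<dots> = 2 * P + 2 * \<Gamma>"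
      unfolding P_def \<Gamma>_def ground_const_def p_def[symmetric] D_def[symmetric] by (simp add: nn_integral_add nn_integral_cmult)
    finally show ?thesis .
  qed
  have pointwise: "energy_density a u (x, y) * far \<delta> k (x, y) + (FP (x, y) + FP (y, x))
      = FQ (x, y) + FQ (y, x) + ground_density a k v (x, y) * far \<delta> k (x, y)"
    if x: "x \<in> half_space k" and y: "y \<in> half_space k" for x y
  proof -
    define b where "b = (x $ k) powr p"
    define c where "c = (y $ k) powr p"
    define N where "N = norm (x - y) powr (- (real CARD('n) + a))"
    have xy: "x $ k > 0" "y $ k > 0" using x y by (auto simp: half_space_def)
    then have bc: "b > 0" "c > 0" by (auto simp: b_def c_def)
    have e: "exp (p * (ln (x $ k) - ln (y $ k))) = b / c" "exp (p * (ln (y $ k) - ln (x $ k))) = c / b"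
      using xy by (auto simp: b_def c_def powr_def exp_diff right_diff_distrib)
    have D_sym: "indicator D (ln (y $ k) - ln (x $ k)) = (indicator D (ln (x $ k) - ln (y $ k)) :: ennreal)"
      by (simp add: D_def indicator_def abs_minus_commute)
    have N_sym: "norm (y - x) powr (- (real CARD('n) + a)) = N" by (simp add: N_def norm_minus_commute)
    have "(u x - u y)\<^sup>2 + ((u y)\<^sup>2 * (b / c) + (u x)\<^sup>2 * (c / b)) = (u y)\<^sup>2 + (u x)\<^sup>2 + b * c * (u x / b - u y / c)\<^sup>2"
      using bc by (simp add: field_simps power2_eq_square)
    then have "(u x - u y)\<^sup>2 * N + ((u y)\<^sup>2 * (b / c) * N + (u x)\<^sup>2 * (c / b) * N)
        = (u y)\<^sup>2 * N + (u x)\<^sup>2 * N + b * c * (v x - v y)\<^sup>2 * N"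
      unfolding v_def b_def[symmetric] c_def[symmetric] by (simp only: distrib_right[symmetric])
    moreover have "N \<ge> 0" by (simp add: N_def)
    then have "0 \<le> (u x - u y)\<^sup>2 * N" "0 \<le> (u y)\<^sup>2 * (b / c) * N" "0 \<le> (u x)\<^sup>2 * (c / b) * N"
      "0 \<le> (u y)\<^sup>2 * N" "0 \<le> (u x)\<^sup>2 * N" "0 \<le> b * c * (v x - v y)\<^sup>2 * N"
      using bc by simp_all
    ultimately have "ennreal ((u x - u y)\<^sup>2 * N) + (ennreal ((u y)\<^sup>2 * (b / c) * N) + ennreal ((u x)\<^sup>2 * (c / b) * N))
        = ennreal ((u y)\<^sup>2 * N) + ennreal ((u x)\<^sup>2 * N) + ennreal (b * c * (v x - v y)\<^sup>2 * N)"
      by (simp only: ennreal_plus[symmetric] add_nonneg_nonneg)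
    note sum_eq = this
    define I :: ennreal where "I = indicator D (ln (x $ k) - ln (y $ k))"
    have N0: "N \<ge> 0" "b / c \<ge> 0" "c / b \<ge> 0" using bc by (simp_all add: N_def)
    have split: "ennreal (s\<^sup>2 * t * N) = ennreal (s\<^sup>2) * ennreal t * ennreal N" if "t \<ge> 0" for s t :: real
      using that N0 by (simp add: ennreal_mult)
    have split': "ennreal (s\<^sup>2 * N) = ennreal (s\<^sup>2) * ennreal N" for s :: real
      using N0 by (simp add: ennreal_mult)
    have "energy_density a u (x, y) = ennreal ((u x - u y)\<^sup>2 * N)"
      unfolding energy_density_def N_def prod.case ..
    moreover have "far \<delta> k (x, y) = I" unfolding far_def I_def D_def prod.case ..
    moreover have "FP (x, y) = ennreal ((u y)\<^sup>2 * (b / c) * N) * I"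
      unfolding FP_def prod.case e N_def[symmetric] I_def[symmetric] split[OF N0(2)] by (simp only: mult_ac)
    moreover have "FP (y, x) = ennreal ((u x)\<^sup>2 * (c / b) * N) * I"
      unfolding FP_def prod.case e N_sym D_sym I_def[symmetric] split[OF N0(3)] by (simp only: mult_ac)
    moreover have "FQ (x, y) = ennreal ((u y)\<^sup>2 * N) * I"
      unfolding FQ_def prod.case N_def[symmetric] I_def[symmetric] split' by (simp only: mult_ac)
    moreover have "FQ (y, x) = ennreal ((u x)\<^sup>2 * N) * I"
      unfolding FQ_def prod.case N_sym D_sym I_def[symmetric] split' by (simp only: mult_ac)
    moreover have "ground_density a k v (x, y) = ennreal (b * c * (v x - v y)\<^sup>2 * N)"
      unfolding ground_density_def N_def b_def c_def p_def prod.case ..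
    ultimately show ?thesis using sum_eq by (simp only: distrib_right[symmetric])
  qed
  define E where "E = dint k (\<lambda>z. energy_density a u z * far \<delta> k z)"
  define G where "G = dint k (\<lambda>z. ground_density a k v z * far \<delta> k z)"
  \<comment> \<open>\<open>FP\<close> and \<open>FQ\<close> enter the pointwise identity only
    through sums over both orders of the pair, and each such sum integrates to twice a single
    term.\<close>
  have "E + 2 * dint k FP = dint k (\<lambda>z. energy_density a u z * far \<delta> k z + (FP z + (\<lambda>(x, y). FP (y, x)) z))"
    unfolding E_def by (subst dint_add) (auto simp: dint_symmetrize)
  also have "\<dots> = dint k (\<lambda>z. (FQ z + (\<lambda>(x, y). FQ (y, x)) z) + ground_density a k v z * far \<delta> k z)"
    by (rule dint_cong) (simp add: pointwise)
  also have "\<dots> = 2 * dint k FQ + G"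
    unfolding G_def by (subst dint_add) (auto simp: dint_symmetrize)
  also have "\<dots> = C * h * (2 * Q) + G" unfolding FQ by (simp add: mult_ac)
  also have "\<dots> = (2 * (C * (h * \<Gamma>)) + G) + 2 * (C * (h * P))"
    unfolding PQ by (simp add: distrib_left mult_ac add_ac)
  finally have "E + 2 * (C * (h * P)) = (2 * (C * (h * \<Gamma>)) + G) + 2 * (C * (h * P))" unfolding FP .
  then have "2 * (C * (h * P)) + E = 2 * (C * (h * P)) + (2 * (C * (h * \<Gamma>)) + G)" by (simp only: add.commute)
  moreover have "2 * (C * (h * P)) \<noteq> \<infinity>"
    using h log_kernel_tail[OF a \<delta>] unfolding C_def h_def P_def D_def
    by (simp add: ennreal_mult_eq_top_iff less_top)
  ultimately have "E = 2 * (C * (h * \<Gamma>)) + G"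
    unfolding ennreal_add_left_cancel by blast
  then show ?thesis unfolding E_def G_def C_def h_def \<Gamma>_def v_def p_def .
qed

text \<open>Monotone convergence. The point \<open>r = 0\<close>, which every cut-off omits,
  contributes nothing since \<open>cosh 0 = 1\<close>.\<close>

lemma ground_const_SUP:
  fixes a :: real
  assumes a: "0 < a" "a < 2"
  shows "(SUP n. ground_const a (1 / real (Suc n))) = ennreal ((Beta ((1 + a) / 2) ((2 - a) / 2) - 2 powr a) / (a * 2 powr a))"
proof -
  define f where "f r = ennreal ((cosh ((a - 1) / 2 * r) - 1) * log_kernel a r)" for r
  have [measurable]: "f \<in> borel_measurable borel" unfolding f_def by measurable
  have inc: "incseq (\<lambda>n r. f r * indicator {r. 1 / real (Suc n) < \<bar>r\<bar>} r)"
  proof (rule incseq_SucI, rule le_funI, rule mult_left_mono)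
    fix n :: nat and r :: real
    have "1 / real (Suc (Suc n)) \<le> 1 / real (Suc n)" by (simp add: field_simps)
    then show "indicator {r. 1 / real (Suc n) < \<bar>r\<bar>} r \<le> (indicator {r. 1 / real (Suc (Suc n)) < \<bar>r\<bar>} r :: ennreal)"
      by (simp only: indicator_def mem_Collect_eq) auto
  qed simp
  have "(SUP n. ground_const a (1 / real (Suc n))) = (\<integral>\<^sup>+r. (SUP n. f r * indicator {r. 1 / real (Suc n) < \<bar>r\<bar>} r) \<partial>lborel)"
    unfolding ground_const_def f_def[symmetric]
    by (rule nn_integral_monotone_convergence_SUP[OF inc, symmetric]) measurable
  also have "\<dots> = (\<integral>\<^sup>+r. f r \<partial>lborel)"
  proof (rule nn_integral_cong)
    fix r :: real
    show "(SUP n. f r * indicator {r. 1 / real (Suc n) < \<bar>r\<bar>} r) = f r"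
    proof (cases "r = 0")
      case True
      then show ?thesis by (simp add: f_def)
    next
      case False
      then obtain n where "inverse (real (Suc n)) < \<bar>r\<bar>" using reals_Archimedean[of "\<bar>r\<bar>"] by auto
      then have "f r \<le> (SUP n. f r * indicator {r. 1 / real (Suc n) < \<bar>r\<bar>} r)"
        by (intro SUP_upper2[of n]) (auto simp: inverse_eq_divide indicator_def)
      moreover have "(SUP n. f r * indicator {r. 1 / real (Suc n) < \<bar>r\<bar>} r) \<le> f r"
        by (rule SUP_least) (auto split: split_indicator)
      ultimately show ?thesis by (intro antisym)
    qed
  qed
  finally show ?thesis unfolding f_def nn_integral_ground_state[OF a] .
qed

section \<open>The inequality\<close>

lemma half_double_ennreal: "1/2 * (2 * x) = (x :: ennreal)"
proof -
  have "ennreal (1/2) * ennreal 2 = 1" by (subst ennreal_mult[symmetric]) auto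
  then have "1/2 * 2 = (1 :: ennreal)" using divide_ennreal[of 1 2] by simp
  then show ?thesis by (simp only: mult.assoc[symmetric] mult_1)
qed

lemma slice_const_nonneg: "a > 0 \<Longrightarrow> slice_const d a \<ge> 0"
  unfolding slice_const_def by (intro mult_nonneg_nonneg divide_nonneg_nonneg Gamma_real_nonneg) auto

lemma ennreal_kappa:
  fixes a :: real
  assumes a: "0 < a" "a < 2"
  shows "ennreal (kappa d a) = ennreal (slice_const d a) * (SUP n. ground_const a (1 / real (Suc n)))"
  unfolding ground_const_SUP[OF a] kappa_def slice_const_def[symmetric]
  by (rule ennreal_mult'[OF slice_const_nonneg[OF a(1)]])

lemma Cc_bounded:
  fixes u :: "real^'n::finite \<Rightarrow> real"
  assumes "u \<in> Cc D"
  obtains B where "\<And>x. \<bar>u x\<bar> \<le> B" 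
proof -
  let ?S = "closure {x. u x \<noteq> 0}"
  have "compact (u ` ?S)"
    using assms by (intro compact_continuous_image) (auto simp: Cc_def intro: continuous_on_subset)
  then obtain B where B: "\<And>x. x \<in> ?S \<Longrightarrow> \<bar>u x\<bar> \<le> B"
    using compact_imp_bounded bounded_iff by (metis imageI real_norm_def)
  have "\<bar>u x\<bar> \<le> max B 0" for x
    using B[of x] closure_subset[of "{x. u x \<noteq> 0}"] by (cases "u x = 0") (auto simp: le_max_iff_disj)
  then show thesis using that by blast
qed

text \<open>On the compact support the height attains a positive minimum, so the weight is bounded
  there. Finiteness is what allows terms to be cancelled in the representation.\<close>

lemma hardy_integral_finite:
  fixes u :: "real^'n::finite \<Rightarrow> real"
  assumes u: "u \<in> Cc (half_space k)" and a: "a > 0"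
  shows "hardy_integral a k u < \<top>"
proof (cases "closure {x. u x \<noteq> 0} = {}")
  case True
  then have "u x = 0" for x using closure_subset[of "{x. u x \<noteq> 0}"] by auto
  then show ?thesis by (simp add: hardy_integral_def)
next
  case False
  let ?S = "closure {x. u x \<noteq> 0}"
  have S: "compact ?S" "?S \<subseteq> half_space k" using u by (auto simp: Cc_def)
  obtain B where B: "\<And>x. \<bar>u x\<bar> \<le> B" using Cc_bounded[OF u] by blast
  obtain x0 where x0: "x0 \<in> ?S" "\<And>x. x \<in> ?S \<Longrightarrow> x0 $ k \<le> x $ k"
  proof -
    have "continuous_on ?S (\<lambda>x. x $ k)" by (intro continuous_intros)
    from continuous_attains_inf[OF S(1) False this] show thesis using that by blast
  qed
  have pos: "x0 $ k > 0" using x0 S by (auto simp: half_space_def)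
  have "hardy_integral a k u \<le> (\<integral>\<^sup>+x. ennreal (B\<^sup>2 * (x0 $ k) powr (- a)) * indicator ?S x \<partial>lborel)"
    unfolding hardy_integral_def
  proof (rule nn_integral_mono)
    fix x
    show "ennreal ((u x)\<^sup>2 * (x $ k) powr (- a)) * indicator (half_space k) x \<le> ennreal (B\<^sup>2 * (x0 $ k) powr (- a)) * indicator ?S x"
    proof (cases "x \<in> ?S")
      case True
      have "(u x)\<^sup>2 * (x $ k) powr (- a) \<le> B\<^sup>2 * (x0 $ k) powr (- a)"
      proof (intro mult_mono powr_mono2')
        show "(u x)\<^sup>2 \<le> B\<^sup>2" using B[of x] by (simp flip: abs_le_square_iff)
      qed (use a pos x0 True in auto)
      then show ?thesis using True S by (auto intro!: ennreal_leI)
    next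
      case False
      then have "u x = 0" using closure_subset[of "{x. u x \<noteq> 0}"] by auto
      then show ?thesis by simp
    qed
  qed
  also have "\<dots> = ennreal (B\<^sup>2 * (x0 $ k) powr (- a)) * emeasure lborel ?S"
    by (rule nn_integral_cmult_indicator) (simp add: borel_closed)
  also have "\<dots> < \<top>"
    using emeasure_compact_finite[OF S(1)] by (simp add: ennreal_mult_less_top less_top)
  finally show ?thesis .
qed

text \<open>For each cut-off the nonnegative remainder is dropped and the truncated energy is
  bounded by the full one; the supremum of the resulting constants is \<open>kappa\<close>.\<close>

lemma fractional_hardy_inequality:
  fixes u :: "real^'n::finite \<Rightarrow> real"
  assumes a: "0 < a" "a < 2" and u: "u \<in> Cc (half_space k)"
  shows "ennreal (kappa CARD('n) a) * hardy_integral a k u \<le> energy a (half_space k) u"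
proof -
  have [measurable]: "u \<in> borel_measurable borel"
    using u by (auto simp: Cc_def intro: borel_measurable_continuous_onI)
  define h where "h = hardy_integral a k u"
  define C where "C = ennreal (slice_const CARD('n) a)"
  have "C * ground_const a (1 / real (Suc n)) * h \<le> energy a (half_space k) u" for n
  proof -
    have "2 * (C * (h * ground_const a (1 / real (Suc n)))) \<le> dint k (\<lambda>z. energy_density a u z * far (1 / real (Suc n)) k z)"
      unfolding C_def h_def using ground_state_representation_far[OF a _ _ hardy_integral_finite[OF u a(1)], of "1 / real (Suc n)"] by simp
    also have "\<dots> \<le> dint k (energy_density a u)"
      by (rule dint_mono) (auto simp: far_def split: split_indicator)
    finally have *: "1/2 * (2 * (C * (h * ground_const a (1 / real (Suc n))))) \<le> 1/2 * dint k (energy_density a u)"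
      by (rule mult_left_mono) simp
    show ?thesis using *[unfolded half_double_ennreal] unfolding energy_eq_dint by (simp only: mult_ac)
  qed
  then have "(SUP n. C * ground_const a (1 / real (Suc n)) * h) \<le> energy a (half_space k) u"
    by (intro SUP_least)
  also have "(SUP n. C * ground_const a (1 / real (Suc n)) * h) = C * (SUP n. ground_const a (1 / real (Suc n))) * h"
    by (simp add: SUP_mult_left_ennreal SUP_mult_right_ennreal)
  finally show ?thesis unfolding ennreal_kappa[OF a] C_def h_def .
qed

section \<open>The upper bound for the energy\<close>

lemma AE_vec_nth_neq: "AE x in lborel. (x::real^'n::finite) $ k \<noteq> c"
proof -
  have "negligible {x::real^'n. x $ k = c}" by (simp add: cart_eq_inner_axis negligible_standard_hyperplane)
  then have "{x::real^'n. x $ k = c} \<in> null_sets lborel"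
    by (simp add: negligible_iff_null_sets null_sets_completion_iff)
  then show ?thesis by (rule AE_I') auto
qed

text \<open>The cut-offs exhaust all pairs of different heights, and for fixed \<open>y\<close> the
  hyperplane of points at the height of \<open>y\<close> is a null set. Monotone convergence is
  applied to the inner and then to the outer integral.\<close>

lemma dint_eq_SUP_far:
  fixes F :: "(real^'n::finite) \<times> (real^'n) \<Rightarrow> ennreal"
  assumes [measurable]: "F \<in> borel_measurable (borel \<Otimes>\<^sub>M borel)"
  shows "dint k F = (SUP n. dint k (\<lambda>z. F z * far (1 / real (Suc n)) k z))"
proof -
  define f where "f n x y = F (x, y) * far (1 / real (Suc n)) k (x, y) * indicator (half_space k) x * indicator (half_space k) y" for n x y
  have [measurable]: "(\<lambda>(x, y). f n x y) \<in> borel_measurable (borel \<Otimes>\<^sub>M borel)" for n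
    unfolding f_def by measurable
  have f_Suc: "f n x y \<le> f (Suc n) x y" for n x y
  proof -
    have "1 / real (Suc (Suc n)) \<le> 1 / real (Suc n)" by (simp add: field_simps)
    then have "far (1 / real (Suc n)) k (x, y) \<le> far (1 / real (Suc (Suc n))) k (x, y)"
      unfolding far_def by (simp only: prod.case indicator_def mem_Collect_eq) auto
    then show ?thesis unfolding f_def by (intro mult_right_mono mult_left_mono) auto
  qed
  have inc: "incseq (\<lambda>n x. f n x y)" for y
    by (intro incseq_SucI le_funI f_Suc)
  have inc': "incseq (\<lambda>n y. \<integral>\<^sup>+x. f n x y \<partial>lborel)"
    by (intro incseq_SucI le_funI nn_integral_mono f_Suc)
  have "dint k F = (\<integral>\<^sup>+y. (\<integral>\<^sup>+x. F (x, y) * indicator (half_space k) x * indicator (half_space k) y \<partial>lborel) \<partial>lborel)"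
    unfolding dint_def by (simp add: nn_integral_multc)
  also have "\<dots> = (\<integral>\<^sup>+y. (\<integral>\<^sup>+x. (SUP n. f n x y) \<partial>lborel) \<partial>lborel)"
  proof (rule nn_integral_cong, rule nn_integral_cong_AE, rule AE_mp[OF AE_vec_nth_neq], rule AE_I2, rule impI)
    fix x y :: "real^'n" assume neq: "x $ k \<noteq> y $ k"
    have "(SUP n. f n x y) \<le> F (x, y) * indicator (half_space k) x * indicator (half_space k) y"
      by (rule SUP_least) (auto simp: f_def far_def split: split_indicator)
    moreover have "F (x, y) * indicator (half_space k) x * indicator (half_space k) y \<le> (SUP n. f n x y)"
    proof (cases "x \<in> half_space k \<and> y \<in> half_space k")
      case True
      then have "\<bar>ln (x $ k) - ln (y $ k)\<bar> > 0" using neq by (simp add: half_space_def)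
      then obtain n where "inverse (real (Suc n)) < \<bar>ln (x $ k) - ln (y $ k)\<bar>" using reals_Archimedean by blast
      then show ?thesis
        by (intro SUP_upper2[of n]) (auto simp: f_def far_def inverse_eq_divide indicator_def)
    qed auto
    ultimately show "F (x, y) * indicator (half_space k) x * indicator (half_space k) y = (SUP n. f n x y)"
      by (rule antisym[rotated])
  qed
  also have "\<dots> = (\<integral>\<^sup>+y. (SUP n. \<integral>\<^sup>+x. f n x y \<partial>lborel) \<partial>lborel)"
    by (intro nn_integral_cong nn_integral_monotone_convergence_SUP inc) measurable
  also have "\<dots> = (SUP n. \<integral>\<^sup>+y. (\<integral>\<^sup>+x. f n x y \<partial>lborel) \<partial>lborel)"
    by (intro nn_integral_monotone_convergence_SUP inc') measurable
  also have "\<dots> = (SUP n. dint k (\<lambda>z. F z * far (1 / real (Suc n)) k z))"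
    unfolding dint_def f_def by (simp add: nn_integral_multc)
  finally show ?thesis .
qed

text \<open>This is the half of the untruncated representation that optimality needs: any excess of
  the energy over the Hardy term must come from the remainder.\<close>

lemma energy_le_ground_state:
  fixes u :: "real^'n::finite \<Rightarrow> real"
  assumes a: "0 < a" "a < 2"
    and u [measurable]: "u \<in> borel_measurable borel" and h: "hardy_integral a k u < \<top>"
  shows "energy a (half_space k) u \<le> ennreal (kappa CARD('n) a) * hardy_integral a k u
     + 1/2 * dint k (ground_density a k (\<lambda>x. u x / (x $ k) powr ((a - 1) / 2)))"
proof -
  define v where "v x = u x / (x $ k) powr ((a - 1) / 2)" for x
  define h' where "h' = ennreal (kappa CARD('n) a) * hardy_integral a k u"
  have "dint k (energy_density a u) = (SUP n. dint k (\<lambda>z. energy_density a u z * far (1 / real (Suc n)) k z))"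
    by (rule dint_eq_SUP_far) measurable
  also have "\<dots> \<le> 2 * h' + dint k (ground_density a k v)"
  proof (rule SUP_least)
    fix n
    have "dint k (\<lambda>z. energy_density a u z * far (1 / real (Suc n)) k z)
      = 2 * (ennreal (slice_const CARD('n) a) * (hardy_integral a k u * ground_const a (1 / real (Suc n))))
        + dint k (\<lambda>z. ground_density a k v z * far (1 / real (Suc n)) k z)"
      unfolding v_def by (rule ground_state_representation_far[OF a _ u h]) simp
    also have "\<dots> \<le> 2 * h' + dint k (ground_density a k v)"
    proof (rule add_mono)
      have "ground_const a (1 / real (Suc n)) \<le> (SUP n. ground_const a (1 / real (Suc n)))" by (rule SUP_upper) simp
      then have "2 * (ennreal (slice_const CARD('n) a) * (hardy_integral a k u * ground_const a (1 / real (Suc n))))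
         \<le> 2 * (ennreal (slice_const CARD('n) a) * (hardy_integral a k u * (SUP n. ground_const a (1 / real (Suc n)))))"
        by (intro mult_left_mono) auto
      then show "2 * (ennreal (slice_const CARD('n) a) * (hardy_integral a k u * ground_const a (1 / real (Suc n)))) \<le> 2 * h'"
        unfolding h'_def ennreal_kappa[OF a] by (simp only: mult_ac)
      show "dint k (\<lambda>z. ground_density a k v z * far (1 / real (Suc n)) k z) \<le> dint k (ground_density a k v)"
        by (rule dint_mono) (auto simp: far_def split: split_indicator)
    qed
    finally show "dint k (\<lambda>z. energy_density a u z * far (1 / real (Suc n)) k z) \<le> 2 * h' + dint k (ground_density a k v)" .
  qed
  finally have "1/2 * dint k (energy_density a u) \<le> 1/2 * (2 * h' + dint k (ground_density a k v))"
    by (rule mult_left_mono) simp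
  then show ?thesis
    unfolding energy_eq_dint distrib_left half_double_ennreal h'_def v_def .
qed

section \<open>Building blocks of the trial functions\<close>

text \<open>The weight \<open>(x $ k) powr (-1)\<close> is the density of the logarithmic height,
  which thus acts as one more Cartesian coordinate.\<close>

lemma nn_integral_half_space_prod:
  fixes f :: "real \<Rightarrow> ennreal" and g :: "real \<Rightarrow> ennreal"
  assumes [measurable]: "f \<in> borel_measurable borel" "g \<in> borel_measurable borel"
  shows "(\<integral>\<^sup>+x\<in>half_space k. (\<Prod>i\<in>UNIV - {k}. f ((x::real^'n::finite) $ i)) * (g (ln (x $ k)) * ennreal ((x $ k) powr (-1))) \<partial>lborel)
    = (\<integral>\<^sup>+t. f t \<partial>lborel) ^ (CARD('n) - 1) * (\<integral>\<^sup>+s. g s \<partial>lborel)"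
proof -
  define F where "F i t = (if i = k then g (ln t) * ennreal (t powr (-1)) * indicator {0<..} t else f t)" for i t
  have [measurable]: "F i \<in> borel_measurable borel" for i unfolding F_def by (cases "i = k") auto
  have "(\<integral>\<^sup>+x\<in>half_space k. (\<Prod>i\<in>UNIV - {k}. f ((x::real^'n) $ i)) * (g (ln (x $ k)) * ennreal ((x $ k) powr (-1))) \<partial>lborel)
    = (\<integral>\<^sup>+x. (\<Prod>i\<in>UNIV. F i ((x::real^'n) $ i)) \<partial>lborel)"
  proof (rule nn_integral_cong)
    fix x :: "real^'n"
    have "(\<Prod>i\<in>UNIV. F i (x $ i)) = F k (x $ k) * (\<Prod>i\<in>UNIV - {k}. F i (x $ i))"
      by (rule prod.remove) auto
    also have "(\<Prod>i\<in>UNIV - {k}. F i (x $ i)) = (\<Prod>i\<in>UNIV - {k}. f (x $ i))"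
      by (rule prod.cong) (auto simp: F_def)
    moreover have "F k (x $ k) = g (ln (x $ k)) * ennreal ((x $ k) powr (-1)) * indicator (half_space k) x"
      by (simp add: F_def half_space_def indicator_def)
    ultimately show "(\<Prod>i\<in>UNIV - {k}. f (x $ i)) * (g (ln (x $ k)) * ennreal ((x $ k) powr (-1))) * indicator (half_space k) x = (\<Prod>i\<in>UNIV. F i (x $ i))"
      by (simp only: mult_ac)
  qed
  also have "\<dots> = (\<Prod>i\<in>UNIV. \<integral>\<^sup>+t. F i t \<partial>lborel)"
    by (rule nn_integral_vec_prod) measurable
  also have "\<dots> = (\<integral>\<^sup>+t. F k t \<partial>lborel) * (\<Prod>i\<in>UNIV - {k}. \<integral>\<^sup>+t. F i t \<partial>lborel)"
    by (rule prod.remove) auto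
  also have "(\<Prod>i\<in>UNIV - {k}. \<integral>\<^sup>+t. F i t \<partial>lborel) = (\<Prod>i\<in>UNIV - {k}. \<integral>\<^sup>+t. f t \<partial>lborel)"
    by (rule prod.cong) (auto simp: F_def)
  also have "\<dots> = (\<integral>\<^sup>+t. f t \<partial>lborel) ^ (CARD('n) - 1)"
    by (simp add: card_Diff_singleton)
  also have "(\<integral>\<^sup>+t. F k t \<partial>lborel) = (\<integral>\<^sup>+s. g s * ennreal (exp s powr (-1)) * ennreal (exp s) \<partial>lborel)"
    unfolding F_def by (simp add: nn_integral_exp_subst)
  also have "\<dots> = (\<integral>\<^sup>+s. g s \<partial>lborel)"
    by (intro nn_integral_cong) (simp add: powr_def mult.assoc flip: ennreal_mult exp_add)
  finally show ?thesis by (simp add: mult.commute)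
qed

text \<open>The sign is not visible in the difference of the Beta value and the power of 2, but it
  is clear from the integral. It is needed because \<open>ennreal\<close> is additive only on
  nonnegative reals.\<close>

lemma kappa_nonneg:
  fixes a :: real
  assumes a: "0 < a" "a < 2"
  shows "kappa d a \<ge> 0"
proof -
  have "(Beta ((1 + a) / 2) ((2 - a) / 2) - 2 powr a) / (a * 2 powr a) \<ge> 0"
    by (rule has_integral_nonneg[OF has_integral_ground_state[OF a]]) auto
  then show ?thesis
    unfolding kappa_def slice_const_def[symmetric] by (intro mult_nonneg_nonneg slice_const_nonneg a)
qed

text \<open>One profile serves twice: in the logarithmic height with width \<open>n\<close>, and in
  each tangential coordinate with width \<open>R\<close>.\<close>

definition tent :: "real \<Rightarrow> real \<Rightarrow> real" where
  "tent R t = max 0 (1 - \<bar>t\<bar> / R)"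

lemma continuous_on_tent [continuous_intros]:
  "continuous_on S f \<Longrightarrow> continuous_on S (\<lambda>x. tent R (f x))"
  unfolding tent_def by (cases "R = 0") (auto intro!: continuous_intros)

lemma tent_measurable [measurable]: "tent R \<in> borel_measurable borel"
  unfolding tent_def by measurable

lemma tent_bounds: "0 \<le> tent R t" "R > 0 \<Longrightarrow> tent R t \<le> 1"
  by (auto simp: tent_def)

lemma tent_eq_0: "R > 0 \<Longrightarrow> \<bar>t\<bar> \<ge> R \<Longrightarrow> tent R t = 0"
  by (auto simp: tent_def field_simps)

lemma tent_lipschitz: "R > 0 \<Longrightarrow> \<bar>tent R s - tent R t\<bar> \<le> \<bar>s - t\<bar> / R"
proof -
  assume R: "R > 0"
  have "\<bar>tent R s - tent R t\<bar> \<le> \<bar>\<bar>s\<bar> / R - \<bar>t\<bar> / R\<bar>" unfolding tent_def by linarith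
  also have "\<dots> = \<bar>\<bar>s\<bar> - \<bar>t\<bar>\<bar> / R" using R by (simp add: diff_divide_distrib[symmetric])
  also have "\<dots> \<le> \<bar>s - t\<bar> / R" using R by (intro divide_right_mono) auto
  finally show ?thesis .
qed

text \<open>The tent is at least 1/2 on the middle interval of length \<open>R\<close>.\<close>

lemma tent_square_integral_ge:
  assumes R: "R > 0"
  shows "ennreal (R / 4) \<le> (\<integral>\<^sup>+t. ennreal ((tent R t)\<^sup>2) \<partial>lborel)"
proof -
  have "ennreal (R / 4) = (\<integral>\<^sup>+t. ennreal (1/4) * indicator {-(R/2)..R/2} t \<partial>lborel)"
    using R by (subst nn_integral_cmult_indicator) (auto simp flip: ennreal_mult)
  also have "\<dots> \<le> (\<integral>\<^sup>+t. ennreal ((tent R t)\<^sup>2) \<partial>lborel)"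
  proof (rule nn_integral_mono)
    fix t
    show "ennreal (1/4) * indicator {-(R/2)..R/2} t \<le> ennreal ((tent R t)\<^sup>2)"
    proof (cases "t \<in> {-(R/2)..R/2}")
      case True
      then have "\<bar>t\<bar> / R \<le> 1/2" using R by (auto simp: field_simps abs_if)
      then have "1/2 \<le> 1 - \<bar>t\<bar> / R" by linarith
      then have "1/2 \<le> tent R t" unfolding tent_def by (rule order_trans) simp
      then have "(1/2)\<^sup>2 \<le> (tent R t)\<^sup>2" by (intro power_mono) auto
      then show ?thesis using True by (auto simp: power2_eq_square intro!: ennreal_leI)
    qed simp
  qed
  finally show ?thesis .
qed

text \<open>The Lipschitz constant contributes \<open>r^2 / R^2\<close>, and one of
  \<open>s\<close>, \<open>s + r\<close> must lie in an interval of length \<open>2 * R\<close>,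
  which gives \<open>4 * R\<close>. The order \<open>1 / R\<close>, against a square integral of
  order \<open>R\<close>, makes wide profiles nearly optimal.\<close>

lemma tent_log_energy:
  fixes a :: real
  assumes R: "R > 0"
  shows "(\<integral>\<^sup>+s. (\<integral>\<^sup>+r. ennreal ((tent R s - tent R (s + r))\<^sup>2 * log_kernel a r) \<partial>lborel) \<partial>lborel)
     \<le> ennreal (4 / R) * (\<integral>\<^sup>+r. ennreal (r\<^sup>2 * log_kernel a r) \<partial>lborel)"
proof -
  have "(\<integral>\<^sup>+s. (\<integral>\<^sup>+r. ennreal ((tent R s - tent R (s + r))\<^sup>2 * log_kernel a r) \<partial>lborel) \<partial>lborel)
     \<le> (\<integral>\<^sup>+s. (\<integral>\<^sup>+r. ennreal (1 / R\<^sup>2) * ennreal (r\<^sup>2 * log_kernel a r) * (indicator {-R..R} s + indicator {-R..R} (s + r)) \<partial>lborel) \<partial>lborel)"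
  proof (intro nn_integral_mono)
    fix s r
    show "ennreal ((tent R s - tent R (s + r))\<^sup>2 * log_kernel a r) \<le> ennreal (1 / R\<^sup>2) * ennreal (r\<^sup>2 * log_kernel a r) * (indicator {-R..R} s + indicator {-R..R} (s + r))"
    proof (cases "s \<in> {-R..R} \<or> s + r \<in> {-R..R}")
      case True
      have "\<bar>tent R s - tent R (s + r)\<bar> \<le> \<bar>r\<bar> / R" using tent_lipschitz[OF R, of s "s + r"] by simp
      then have "\<bar>tent R s - tent R (s + r)\<bar>\<^sup>2 \<le> (\<bar>r\<bar> / R)\<^sup>2" by (rule power_mono) simp
      then have "(tent R s - tent R (s + r))\<^sup>2 * log_kernel a r \<le> (\<bar>r\<bar> / R)\<^sup>2 * log_kernel a r"
        by (intro mult_right_mono) auto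
      also have "\<dots> = 1 / R\<^sup>2 * (r\<^sup>2 * log_kernel a r)" by (simp add: power_divide)
      finally have "ennreal ((tent R s - tent R (s + r))\<^sup>2 * log_kernel a r) \<le> ennreal (1 / R\<^sup>2) * ennreal (r\<^sup>2 * log_kernel a r) * 1"
        by (simp add: ennreal_leI flip: ennreal_mult)
      also have "\<dots> \<le> ennreal (1 / R\<^sup>2) * ennreal (r\<^sup>2 * log_kernel a r) * (indicator {-R..R} s + indicator {-R..R} (s + r))"
        by (intro mult_left_mono) (use True in \<open>auto simp: indicator_def\<close>)
      finally show ?thesis .
    next
      case False
      then have "tent R s = 0" "tent R (s + r) = 0" using R by (auto intro!: tent_eq_0)
      then show ?thesis by simp
    qed
  qed
  also have "\<dots> = (\<integral>\<^sup>+r. (\<integral>\<^sup>+s. ennreal (1 / R\<^sup>2) * ennreal (r\<^sup>2 * log_kernel a r) * (indicator {-R..R} s + indicator {-R..R} (s + r)) \<partial>lborel) \<partial>lborel)"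
    by (rule lborel_pair.Fubini') measurable
  also have "\<dots> = (\<integral>\<^sup>+r. ennreal (4 / R) * ennreal (r\<^sup>2 * log_kernel a r) \<partial>lborel)"
  proof (rule nn_integral_cong)
    fix r
    have 1: "(\<integral>\<^sup>+s. indicator {-R..R} s \<partial>lborel) = ennreal (2 * R)" using R by simp
    have "(\<integral>\<^sup>+s. indicator {-R..R} (s + r) \<partial>lborel) = (\<integral>\<^sup>+s. indicator {-R..R} s \<partial>lborel)"
      by (subst (2) nn_integral_real_affine[where c = 1 and t = r]) (auto simp: add.commute)
    then have 2: "(\<integral>\<^sup>+s. indicator {-R..R} (s + r) \<partial>lborel) = ennreal (2 * R)" using 1 by simp
    have "(\<integral>\<^sup>+s. ennreal (1 / R\<^sup>2) * ennreal (r\<^sup>2 * log_kernel a r) * (indicator {-R..R} s + indicator {-R..R} (s + r)) \<partial>lborel)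
      = ennreal (1 / R\<^sup>2) * ennreal (r\<^sup>2 * log_kernel a r) * (ennreal (2 * R) + ennreal (2 * R))"
      by (subst nn_integral_cmult, measurable) (subst nn_integral_add, auto simp only: 1 2, measurable)
    also have "ennreal (2 * R) + ennreal (2 * R) = ennreal (4 * R)" using R by (simp flip: ennreal_plus)
    also have "ennreal (1 / R\<^sup>2) * ennreal (r\<^sup>2 * log_kernel a r) * ennreal (4 * R) = ennreal (1 / R\<^sup>2) * ennreal (4 * R) * ennreal (r\<^sup>2 * log_kernel a r)"
      by (simp only: mult_ac)
    also have "ennreal (1 / R\<^sup>2) * ennreal (4 * R) = ennreal (4 / R)"
      using R by (simp add: power2_eq_square flip: ennreal_mult)
    finally show "(\<integral>\<^sup>+s. ennreal (1 / R\<^sup>2) * ennreal (r\<^sup>2 * log_kernel a r) * (indicator {-R..R} s + indicator {-R..R} (s + r)) \<partial>lborel)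
      = ennreal (4 / R) * ennreal (r\<^sup>2 * log_kernel a r)" .
  qed
  also have "\<dots> = ennreal (4 / R) * (\<integral>\<^sup>+r. ennreal (r\<^sup>2 * log_kernel a r) \<partial>lborel)"
    by (rule nn_integral_cmult) measurable
  finally show ?thesis .
qed

subsection \<open>The remainder of trial functions\<close>

text \<open>A product of tents, not a function of the tangential norm, so that its integrals factor.
  In dimension 1 the product is empty and the cut-off is constantly 1.\<close>

definition cutoff :: "real \<Rightarrow> 'n \<Rightarrow> real^'n::finite \<Rightarrow> real" where
  "cutoff R k x = (\<Prod>i\<in>UNIV - {k}. tent R (x $ i))"

lemma cutoff_measurable [measurable]: "cutoff R k \<in> borel_measurable borel"
  unfolding cutoff_def by measurable

lemma cutoff_bounds: "0 \<le> cutoff R k x" "R > 0 \<Longrightarrow> cutoff R k x \<le> 1"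
  unfolding cutoff_def by (auto intro!: prod_nonneg prod_le_1 simp: tent_bounds)

lemma cutoff_nonzero:
  assumes "R > 0" "cutoff R k x \<noteq> 0" "i \<noteq> k"
  shows "\<bar>x $ i\<bar> \<le> R"
  using assms tent_eq_0[of R "x $ i"] by (force simp: cutoff_def)

lemma cutoff_lipschitz:
  fixes x y :: "real^'n::finite"
  assumes R: "R > 0"
  shows "\<bar>cutoff R k x - cutoff R k y\<bar> \<le> real CARD('n) * norm (x - y) / R"
proof -
  have "\<bar>cutoff R k x - cutoff R k y\<bar> \<le> (\<Sum>i\<in>UNIV - {k}. norm (tent R (x $ i) - tent R (y $ i)))"
    unfolding cutoff_def real_norm_def[symmetric]
    by (rule norm_prod_diff) (use tent_bounds R in auto)
  also have "\<dots> \<le> (\<Sum>i\<in>UNIV - {k}. norm (x - y) / R)"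
  proof (rule sum_mono)
    fix i
    have "norm (tent R (x $ i) - tent R (y $ i)) \<le> \<bar>(x - y) $ i\<bar> / R"
      using tent_lipschitz[OF R] by simp
    also have "\<dots> \<le> norm (x - y) / R"
      using R component_le_norm_cart[of "x - y" i] by (intro divide_right_mono) auto
    finally show "norm (tent R (x $ i) - tent R (y $ i)) \<le> norm (x - y) / R" .
  qed
  also have "\<dots> \<le> (\<Sum>i\<in>(UNIV::'n set). norm (x - y) / R)"
    using R by (intro sum_mono2) auto
  finally show ?thesis by simp
qed

text \<open>The difference is at most 1, so its square is at most its \<open>b\<close>-th power, to
  which the Lipschitz bound applies. Compared with the exponent 2 this gives up decay in
  \<open>R\<close> and gains slower growth in the distance, so that the kernel stays integrable far
  away.\<close>

lemma cutoff_diff_square_le: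
  fixes x y :: "real^'n::finite"
  assumes R: "R > 0" and b: "0 < b" "b \<le> 2"
  shows "(cutoff R k x - cutoff R k y)\<^sup>2 \<le> (real CARD('n) / R) powr b * norm (x - y) powr b"
proof -
  define m where "m = \<bar>cutoff R k x - cutoff R k y\<bar>"
  have m: "0 \<le> m" "m \<le> 1" "m \<le> real CARD('n) / R * norm (x - y)"
    using cutoff_lipschitz[OF R, of k x y] cutoff_bounds[of R k x] cutoff_bounds[of R k y] R
    by (auto simp: m_def)
  have "m\<^sup>2 \<le> m powr b"
  proof (cases "m = 0")
    case False
    then have "m powr 2 \<le> m powr b" using m b by (intro powr_mono') auto
    then show ?thesis using m False by simp
  qed simp
  also have "\<dots> \<le> (real CARD('n) / R * norm (x - y)) powr b"
    using m b by (intro powr_mono2) auto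
  also have "\<dots> = (real CARD('n) / R) powr b * norm (x - y) powr b"
    by (rule powr_mult)
  finally show ?thesis by (simp add: m_def)
qed

definition side_box :: "real \<Rightarrow> 'n \<Rightarrow> real^'n::finite \<Rightarrow> ennreal" where
  "side_box R k x = (\<Prod>i\<in>UNIV - {k}. indicator {-R..R} (x $ i))"

lemma side_box_measurable [measurable]: "side_box R k \<in> borel_measurable borel"
  unfolding side_box_def by measurable

lemma side_box_eq_1:
  assumes "R > 0" "cutoff R k x \<noteq> 0" 
  shows "side_box R k x = 1"
  unfolding side_box_def
proof (rule prod.neutral, rule ballI)
  fix i assume "i \<in> UNIV - {k}"
  then have "\<bar>x $ i\<bar> \<le> R" using cutoff_nonzero[OF assms, of i] by simp
  then show "indicator {-R..R} (x $ i) = (1::ennreal)" by (simp add: abs_le_iff)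
qed

text \<open>This is the quotient \<open>v = u / w\<close> of the representation, not the trial
  function \<open>u\<close> itself.\<close>

definition trial :: "real \<Rightarrow> real \<Rightarrow> 'n \<Rightarrow> real^'n::finite \<Rightarrow> real" where
  "trial n R k x = tent n (ln (x $ k)) * cutoff R k x"

text \<open>With \<open>2 * p = a - 1\<close> all weights cancel: \<open>exp (p * r)\<close> against
  the factor from the change of variables, and \<open>(y $ k) powr (2 * p - a)\<close> becomes the
  logarithmic density. The cut-off is taken at \<open>y\<close> only, so \<open>x\<close> enters
  through its height and \<open>dint_log\<close> applies.\<close>

lemma dint_trial_normal:
  fixes a :: real
  assumes a: "0 < a" "a < 2"
  defines "p \<equiv> (a - 1) / 2"
  shows "dint k (\<lambda>(x, y::real^'n::finite). ennreal ((x $ k) powr p * (y $ k) powr p *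
      ((tent n (ln (x $ k)) - tent n (ln (y $ k)))\<^sup>2 * (cutoff R k y)\<^sup>2) * norm (x - y) powr (- (real CARD('n) + a))))
    = ennreal (slice_const CARD('n) a) * ((\<integral>\<^sup>+t. ennreal ((tent R t)\<^sup>2) \<partial>lborel) ^ (CARD('n) - 1) *
       (\<integral>\<^sup>+s. (\<integral>\<^sup>+r. ennreal ((tent n s - tent n (s + r))\<^sup>2 * log_kernel a r) \<partial>lborel) \<partial>lborel))"
proof -
  define \<Phi> where "\<Phi> = (\<lambda>(y::real^'n, r). ennreal ((cutoff R k y)\<^sup>2 * (y $ k) powr (2 * p) * exp (p * r) * (tent n (ln (y $ k)) - tent n (ln (y $ k) + r))\<^sup>2))"
  have [measurable]: "\<Phi> \<in> borel_measurable (borel \<Otimes>\<^sub>M borel)" unfolding \<Phi>_def by measurable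
  define e where "e s = (\<integral>\<^sup>+r. ennreal ((tent n s - tent n (s + r))\<^sup>2 * log_kernel a r) \<partial>lborel)" for s
  have [measurable]: "e \<in> borel_measurable borel" unfolding e_def by measurable
  have "dint k (\<lambda>(x, y::real^'n). ennreal ((x $ k) powr p * (y $ k) powr p *
      ((tent n (ln (x $ k)) - tent n (ln (y $ k)))\<^sup>2 * (cutoff R k y)\<^sup>2) * norm (x - y) powr (- (real CARD('n) + a))))
    = dint k (\<lambda>(x, y). \<Phi> (y, ln (x $ k) - ln (y $ k)) * ennreal (norm (x - y) powr (- (real CARD('n) + a))))"
  proof (rule dint_cong, unfold prod.case)
    fix x y :: "real^'n" assume "x \<in> half_space k" "y \<in> half_space k"
    then have xy: "x $ k > 0" "y $ k > 0" by (auto simp: half_space_def)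
    have "(y $ k) powr (2 * p) * exp (p * (ln (x $ k) - ln (y $ k))) = (x $ k) powr p * (y $ k) powr p"
      using xy by (simp add: powr_def algebra_simps flip: exp_add)
    then have "(cutoff R k y)\<^sup>2 * ((y $ k) powr (2 * p) * exp (p * (ln (x $ k) - ln (y $ k)))) * (tent n (ln (y $ k)) - tent n (ln (x $ k)))\<^sup>2
        = (cutoff R k y)\<^sup>2 * ((x $ k) powr p * (y $ k) powr p) * (tent n (ln (x $ k)) - tent n (ln (y $ k)))\<^sup>2"
      by (simp only: power2_commute)
    then have "\<Phi> (y, ln (x $ k) - ln (y $ k)) = ennreal ((x $ k) powr p * (y $ k) powr p * ((tent n (ln (x $ k)) - tent n (ln (y $ k)))\<^sup>2 * (cutoff R k y)\<^sup>2))"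
      unfolding \<Phi>_def prod.case by (simp add: mult_ac)
    then show "ennreal ((x $ k) powr p * (y $ k) powr p *
      ((tent n (ln (x $ k)) - tent n (ln (y $ k)))\<^sup>2 * (cutoff R k y)\<^sup>2) * norm (x - y) powr (- (real CARD('n) + a)))
      = \<Phi> (y, ln (x $ k) - ln (y $ k)) * ennreal (norm (x - y) powr (- (real CARD('n) + a)))"
      by (simp add: ennreal_mult)
  qed
  also have "\<dots> = ennreal (slice_const CARD('n) a) * (\<integral>\<^sup>+y\<in>half_space k. ennreal ((y $ k) powr (- a)) *
         (\<integral>\<^sup>+r. \<Phi> (y, r) * ennreal (exp (- ((a - 1) / 2) * r) * log_kernel a r) \<partial>lborel) \<partial>lborel)"
    using a by (intro dint_log) auto
  also have "(\<integral>\<^sup>+y\<in>half_space k. ennreal ((y $ k) powr (- a)) *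
         (\<integral>\<^sup>+r. \<Phi> (y, r) * ennreal (exp (- ((a - 1) / 2) * r) * log_kernel a r) \<partial>lborel) \<partial>lborel)
    = (\<integral>\<^sup>+y\<in>half_space k. (\<Prod>i\<in>UNIV - {k}. ennreal ((tent R (y $ i))\<^sup>2)) * (e (ln (y $ k)) * ennreal ((y $ k) powr (-1))) \<partial>lborel)"
  proof (rule nn_integral_cong)
    fix y :: "real^'n"
    show "ennreal ((y $ k) powr (- a)) *
         (\<integral>\<^sup>+r. \<Phi> (y, r) * ennreal (exp (- ((a - 1) / 2) * r) * log_kernel a r) \<partial>lborel) * indicator (half_space k) y
      = (\<Prod>i\<in>UNIV - {k}. ennreal ((tent R (y $ i))\<^sup>2)) * (e (ln (y $ k)) * ennreal ((y $ k) powr (-1))) * indicator (half_space k) y"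
    proof (cases "y \<in> half_space k")
      case True
      then have y: "y $ k > 0" by (simp add: half_space_def)
      define A where "A = (cutoff R k y)\<^sup>2 * (y $ k) powr (2 * p)"
      have "(\<integral>\<^sup>+r. \<Phi> (y, r) * ennreal (exp (- ((a - 1) / 2) * r) * log_kernel a r) \<partial>lborel)
         = (\<integral>\<^sup>+r. ennreal A * ennreal ((tent n (ln (y $ k)) - tent n (ln (y $ k) + r))\<^sup>2 * log_kernel a r) \<partial>lborel)"
      proof (rule nn_integral_cong)
        fix r
        have 1: "exp (p * r) * exp (- ((a - 1) / 2) * r) = 1" by (simp add: p_def flip: exp_add)
        have "A * exp (p * r) * (tent n (ln (y $ k)) - tent n (ln (y $ k) + r))\<^sup>2 * (exp (- ((a - 1) / 2) * r) * log_kernel a r)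
           = (exp (p * r) * exp (- ((a - 1) / 2) * r)) * (A * ((tent n (ln (y $ k)) - tent n (ln (y $ k) + r))\<^sup>2 * log_kernel a r))"
          by (simp only: mult_ac)
        then have "A * exp (p * r) * (tent n (ln (y $ k)) - tent n (ln (y $ k) + r))\<^sup>2 * (exp (- ((a - 1) / 2) * r) * log_kernel a r)
           = A * ((tent n (ln (y $ k)) - tent n (ln (y $ k) + r))\<^sup>2 * log_kernel a r)"
          unfolding 1 by (simp only: mult_1)
        moreover have "A \<ge> 0" by (simp add: A_def)
        ultimately show "\<Phi> (y, r) * ennreal (exp (- ((a - 1) / 2) * r) * log_kernel a r) = ennreal A * ennreal ((tent n (ln (y $ k)) - tent n (ln (y $ k) + r))\<^sup>2 * log_kernel a r)"
          unfolding \<Phi>_def prod.case A_def[symmetric]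
          by (subst (1 2) ennreal_mult[symmetric]) auto
      qed
      also have "\<dots> = ennreal A * e (ln (y $ k))"
        unfolding e_def by (rule nn_integral_cmult) measurable
      finally have "ennreal ((y $ k) powr (- a)) * (\<integral>\<^sup>+r. \<Phi> (y, r) * ennreal (exp (- ((a - 1) / 2) * r) * log_kernel a r) \<partial>lborel)
         = ennreal ((y $ k) powr (- a)) * ennreal A * e (ln (y $ k))" by (simp only: mult.assoc)
      also have "ennreal ((y $ k) powr (- a)) * ennreal A = ennreal ((y $ k) powr (-1)) * ennreal ((cutoff R k y)\<^sup>2)"
      proof -
        have "- a + 2 * p = - 1" by (simp add: p_def field_simps)
        then have "(y $ k) powr (- a) * (y $ k) powr (2 * p) = (y $ k) powr (-1)"
          by (simp only: powr_add[symmetric])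
        moreover have "(y $ k) powr (- a) * A = ((y $ k) powr (- a) * (y $ k) powr (2 * p)) * (cutoff R k y)\<^sup>2"
          unfolding A_def by (simp only: mult_ac)
        ultimately have "(y $ k) powr (- a) * A = (y $ k) powr (-1) * (cutoff R k y)\<^sup>2" by (simp only:)
        moreover have "A \<ge> 0" by (simp add: A_def)
        ultimately show ?thesis
          by (subst (1 2) ennreal_mult[symmetric]) (simp_all only: powr_ge_zero zero_le_power2)
      qed
      also have "ennreal ((cutoff R k y)\<^sup>2) = (\<Prod>i\<in>UNIV - {k}. ennreal ((tent R (y $ i))\<^sup>2))"
        unfolding cutoff_def by (simp add: prod_ennreal prod_power_distrib)
      finally show ?thesis using True by (simp only: mult_ac)
    qed simp
  qed
  also have "\<dots> = (\<integral>\<^sup>+t. ennreal ((tent R t)\<^sup>2) \<partial>lborel) ^ (CARD('n) - 1) * (\<integral>\<^sup>+s. e s \<partial>lborel)"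
    by (rule nn_integral_half_space_prod) measurable
  finally show ?thesis unfolding e_def .
qed

text \<open>Here \<open>p\<close> and \<open>a\<close> are independent: the weight keeps its
  exponent while the kernel exponent is lowered by \<open>b\<close>. The exponentials then no longer
  cancel, but since \<open>R\<close> is chosen after \<open>n\<close>, only finiteness will
  matter.\<close>

definition tangential_const :: "real \<Rightarrow> real \<Rightarrow> real \<Rightarrow> ennreal" where
  "tangential_const p a n = (\<integral>\<^sup>+s. ennreal (exp ((1 + 2 * p - a) * s) * tent n s) *
     (\<integral>\<^sup>+r. ennreal (exp (p * r) * tent n (s + r)) * ennreal (exp (- ((a - 1) / 2) * r) * log_kernel a r) \<partial>lborel) \<partial>lborel)"

text \<open>Only \<open>y\<close> is confined to the box, which accounts for the power of
  \<open>2 * R\<close>; the tangential directions of \<open>x\<close> are integrated out completely,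
  which is possible for \<open>a > -1\<close>.\<close>

lemma dint_trial_tangential:
  fixes a p :: real
  assumes a: "a > -1" and R: "R > 0"
  shows "dint k (\<lambda>(x, y::real^'n::finite). side_box R k y * ennreal ((x $ k) powr p * (y $ k) powr p *
      (tent n (ln (x $ k)) * tent n (ln (y $ k))) * norm (x - y) powr (- (real CARD('n) + a))))
    = ennreal (slice_const CARD('n) a) * (ennreal (2 * R) ^ (CARD('n) - 1) * tangential_const p a n)"
proof -
  define \<Phi> where "\<Phi> = (\<lambda>(y::real^'n, r). side_box R k y * ennreal ((y $ k) powr (2 * p) * tent n (ln (y $ k))) * ennreal (exp (p * r) * tent n (ln (y $ k) + r)))"
  have [measurable]: "\<Phi> \<in> borel_measurable (borel \<Otimes>\<^sub>M borel)" unfolding \<Phi>_def by measurable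
  define e where "e s = (\<integral>\<^sup>+r. ennreal (exp (p * r) * tent n (s + r)) * ennreal (exp (- ((a - 1) / 2) * r) * log_kernel a r) \<partial>lborel)" for s
  have [measurable]: "e \<in> borel_measurable borel" unfolding e_def by measurable
  define g where "g s = ennreal (exp ((1 + 2 * p - a) * s) * tent n s) * e s" for s
  have [measurable]: "g \<in> borel_measurable borel" unfolding g_def by measurable
  have "dint k (\<lambda>(x, y::real^'n). side_box R k y * ennreal ((x $ k) powr p * (y $ k) powr p *
      (tent n (ln (x $ k)) * tent n (ln (y $ k))) * norm (x - y) powr (- (real CARD('n) + a))))
    = dint k (\<lambda>(x, y). \<Phi> (y, ln (x $ k) - ln (y $ k)) * ennreal (norm (x - y) powr (- (real CARD('n) + a))))"
  proof (rule dint_cong, unfold prod.case)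
    fix x y :: "real^'n" assume "x \<in> half_space k" "y \<in> half_space k"
    then have xy: "x $ k > 0" "y $ k > 0" by (auto simp: half_space_def)
    have 1: "(x $ k) powr p * (y $ k) powr p = (y $ k) powr (2 * p) * exp (p * (ln (x $ k) - ln (y $ k)))"
      using xy by (simp add: powr_def algebra_simps flip: exp_add)
    have 2: "ln (y $ k) + (ln (x $ k) - ln (y $ k)) = ln (x $ k)" by simp
    have "(x $ k) powr p * (y $ k) powr p * (tent n (ln (x $ k)) * tent n (ln (y $ k)))
        = (y $ k) powr (2 * p) * tent n (ln (y $ k)) * (exp (p * (ln (x $ k) - ln (y $ k))) * tent n (ln (y $ k) + (ln (x $ k) - ln (y $ k))))"
      unfolding 1 2 by (simp only: mult_ac)
    then show "side_box R k y * ennreal ((x $ k) powr p * (y $ k) powr p *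
      (tent n (ln (x $ k)) * tent n (ln (y $ k))) * norm (x - y) powr (- (real CARD('n) + a)))
      = \<Phi> (y, ln (x $ k) - ln (y $ k)) * ennreal (norm (x - y) powr (- (real CARD('n) + a)))"
      unfolding \<Phi>_def prod.case mult.assoc[of "side_box R k y"]
      by (simp only: ennreal_mult mult_nonneg_nonneg powr_ge_zero tent_bounds exp_ge_zero norm_ge_zero)
  qed
  also have "\<dots> = ennreal (slice_const CARD('n) a) * (\<integral>\<^sup>+y\<in>half_space k. ennreal ((y $ k) powr (- a)) *
         (\<integral>\<^sup>+r. \<Phi> (y, r) * ennreal (exp (- ((a - 1) / 2) * r) * log_kernel a r) \<partial>lborel) \<partial>lborel)"
    using a by (intro dint_log) auto
  also have "(\<integral>\<^sup>+y\<in>half_space k. ennreal ((y $ k) powr (- a)) *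
         (\<integral>\<^sup>+r. \<Phi> (y, r) * ennreal (exp (- ((a - 1) / 2) * r) * log_kernel a r) \<partial>lborel) \<partial>lborel)
    = (\<integral>\<^sup>+y\<in>half_space k. (\<Prod>i\<in>UNIV - {k}. indicator {-R..R} (y $ i)) * (g (ln (y $ k)) * ennreal ((y $ k) powr (-1))) \<partial>lborel)"
  proof (rule nn_integral_cong)
    fix y :: "real^'n"
    show "ennreal ((y $ k) powr (- a)) *
         (\<integral>\<^sup>+r. \<Phi> (y, r) * ennreal (exp (- ((a - 1) / 2) * r) * log_kernel a r) \<partial>lborel) * indicator (half_space k) y
      = (\<Prod>i\<in>UNIV - {k}. indicator {-R..R} (y $ i)) * (g (ln (y $ k)) * ennreal ((y $ k) powr (-1))) * indicator (half_space k) y"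
    proof (cases "y \<in> half_space k")
      case True
      then have y: "y $ k > 0" by (simp add: half_space_def)
      have "(\<integral>\<^sup>+r. \<Phi> (y, r) * ennreal (exp (- ((a - 1) / 2) * r) * log_kernel a r) \<partial>lborel)
         = side_box R k y * ennreal ((y $ k) powr (2 * p) * tent n (ln (y $ k))) * e (ln (y $ k))"
        unfolding \<Phi>_def prod.case e_def mult.assoc[of "side_box R k y * ennreal ((y $ k) powr (2 * p) * tent n (ln (y $ k)))"]
        by (rule nn_integral_cmult) measurable
      moreover have "ennreal ((y $ k) powr (- a)) * ennreal ((y $ k) powr (2 * p) * tent n (ln (y $ k)))
          = ennreal (exp ((1 + 2 * p - a) * ln (y $ k)) * tent n (ln (y $ k))) * ennreal ((y $ k) powr (-1))"
      proof -
        have "(y $ k) powr (- a) * (y $ k) powr (2 * p) = exp ((1 + 2 * p - a) * ln (y $ k)) * (y $ k) powr (-1)"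
          using y by (simp add: powr_def algebra_simps flip: exp_add)
        then have "(y $ k) powr (- a) * ((y $ k) powr (2 * p) * tent n (ln (y $ k))) = exp ((1 + 2 * p - a) * ln (y $ k)) * tent n (ln (y $ k)) * (y $ k) powr (-1)"
          by (simp only: mult.assoc[symmetric]) (simp only: mult_ac)
        then show ?thesis
          by (subst (1 2) ennreal_mult[symmetric]) (simp_all only: mult_nonneg_nonneg powr_ge_zero tent_bounds exp_ge_zero)
      qed
      moreover have "Y * (S * X * E) = S * ((Y * X) * E)" for Y S X E :: ennreal
        by (simp only: mult_ac)
      ultimately have "ennreal ((y $ k) powr (- a)) * (\<integral>\<^sup>+r. \<Phi> (y, r) * ennreal (exp (- ((a - 1) / 2) * r) * log_kernel a r) \<partial>lborel)
        = side_box R k y * (g (ln (y $ k)) * ennreal ((y $ k) powr (-1)))"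
        unfolding g_def by (simp only:) (simp only: mult_ac)
      then show ?thesis using True unfolding side_box_def by simp
    qed simp
  qed
  also have "\<dots> = (\<integral>\<^sup>+t. indicator {-R..R} t \<partial>lborel) ^ (CARD('n) - 1) * (\<integral>\<^sup>+s. g s \<partial>lborel)"
    by (rule nn_integral_half_space_prod) measurable
  also have "(\<integral>\<^sup>+t. indicator {-R..R} t \<partial>lborel) = ennreal (2 * R)" using R by simp
  finally show ?thesis unfolding g_def e_def tangential_const_def .
qed

lemma nn_integral_powr_interval:
  assumes c: "c > 0" and b: "b > -1"
  shows "(\<integral>\<^sup>+r. ennreal (\<bar>r\<bar> powr b) * indicator {-c..c} r \<partial>lborel) < \<top>"
proof -
  have "(\<integral>\<^sup>+r. ennreal (\<bar>r\<bar> powr b) * indicator {-c..c} r \<partial>lborel)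
     = 2 * (\<integral>\<^sup>+r. ennreal (\<bar>r\<bar> powr b) * indicator {-c..c} r * indicator {0<..} r \<partial>lborel)"
    by (rule nn_integral_even) (auto simp: indicator_def)
  also have "\<dots> \<le> 2 * (\<integral>\<^sup>+r. ennreal (indicator {0..c} r * r powr b) \<partial>lborel)"
    by (intro mult_left_mono nn_integral_mono) (auto split: split_indicator)
  also have "(\<integral>\<^sup>+r. ennreal (indicator {0..c} r * r powr b) \<partial>lborel) = ennreal (c powr (b + 1) / (b + 1))"
    using c b by (intro nn_integral_has_integral_lebesgue has_integral_powr_from_0) auto
  also have "2 * \<dots> < \<top>" by (simp add: ennreal_mult_less_top)
  finally show ?thesis .
qed

lemma mult_le_abs_mult:
  fixes q r c :: real
  assumes "\<bar>r\<bar> \<le> c"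
  shows "q * r \<le> \<bar>q\<bar> * c"
proof -
  have "q * r \<le> \<bar>q\<bar> * \<bar>r\<bar>" using abs_ge_self[of "q * r"] by (simp add: abs_mult)
  also have "\<dots> \<le> \<bar>q\<bar> * c" using assms by (intro mult_left_mono) auto
  finally show ?thesis .
qed

text \<open>Both tents confine the logarithmic heights to an interval of half-width
  \<open>n\<close>, hence \<open>\<bar>r\<bar> \<le> 2 * n\<close>, where the exponentials are
  bounded. The singularity has exponent \<open>1 + a < 1\<close> and is integrable.\<close>

lemma tangential_const_finite:
  assumes n: "n > 0" and a: "-1 < a" "a < 0"
  shows "tangential_const p a n < \<top>"
proof -
  define q where "q = p - (a - 1) / 2"
  define I where "I = (\<integral>\<^sup>+r. ennreal (\<bar>r\<bar> powr (- (1 + a))) * indicator {-(2*n)..2*n} r \<partial>lborel)"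
  have I: "I < \<top>" unfolding I_def using n a by (intro nn_integral_powr_interval) auto
  define K where "K = exp (\<bar>q\<bar> * (2 * n))"
  define L where "L = exp (\<bar>1 + 2 * p - a\<bar> * n)"
  have inner: "(\<integral>\<^sup>+r. ennreal (exp (p * r) * tent n (s + r)) * ennreal (exp (- ((a - 1) / 2) * r) * log_kernel a r) \<partial>lborel) \<le> ennreal K * I"
    if s: "s \<in> {-n..n}" for s
  proof -
    have "(\<integral>\<^sup>+r. ennreal (exp (p * r) * tent n (s + r)) * ennreal (exp (- ((a - 1) / 2) * r) * log_kernel a r) \<partial>lborel)
       \<le> (\<integral>\<^sup>+r. ennreal K * (ennreal (\<bar>r\<bar> powr (- (1 + a))) * indicator {-(2*n)..2*n} r) \<partial>lborel)"
    proof (rule nn_integral_mono)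
      fix r
      show "ennreal (exp (p * r) * tent n (s + r)) * ennreal (exp (- ((a - 1) / 2) * r) * log_kernel a r)
        \<le> ennreal K * (ennreal (\<bar>r\<bar> powr (- (1 + a))) * indicator {-(2*n)..2*n} r)"
      proof (cases "r \<in> {-(2*n)..2*n}")
        case True
        have "exp (p * r) * exp (- ((a - 1) / 2) * r) = exp (q * r)"
          by (simp add: q_def left_diff_distrib flip: exp_add)
        moreover have "q * r \<le> \<bar>q\<bar> * (2 * n)"
          using mult_le_abs_mult[of r "2 * n" q] True by auto
        then have "exp (q * r) \<le> K" by (simp add: K_def)
        ultimately have 1: "exp (p * r) * exp (- ((a - 1) / 2) * r) \<le> K" by simp
        have 2: "tent n (s + r) \<le> 1" using n by (rule tent_bounds)
        have 3: "log_kernel a r \<le> \<bar>r\<bar> powr (- (1 + a))"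
        proof (cases "r = 0")
          case False
          have "log_kernel a r = log_kernel a \<bar>r\<bar>" by (simp add: log_kernel_def)
          then show ?thesis using log_kernel_le[of "\<bar>r\<bar>" a] False a by simp
        qed (simp add: log_kernel_def)
        have "exp (p * r) * tent n (s + r) * (exp (- ((a - 1) / 2) * r) * log_kernel a r)
          = (exp (p * r) * exp (- ((a - 1) / 2) * r)) * (tent n (s + r) * log_kernel a r)" by (simp only: mult_ac)
        also have "\<dots> \<le> K * (1 * \<bar>r\<bar> powr (- (1 + a)))"
          by (intro mult_mono 1 2 3) (auto simp: K_def tent_bounds)
        finally have "ennreal (exp (p * r) * tent n (s + r) * (exp (- ((a - 1) / 2) * r) * log_kernel a r)) \<le> ennreal (K * (1 * \<bar>r\<bar> powr (- (1 + a))))"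
          by (rule ennreal_leI)
        then show ?thesis
          using True by (simp add: ennreal_mult K_def tent_bounds)
      next
        case False
        then have "\<bar>s + r\<bar> \<ge> n" using s by auto
        then have "tent n (s + r) = 0" using n by (intro tent_eq_0)
        then show ?thesis by simp
      qed
    qed
    also have "\<dots> = ennreal K * I" unfolding I_def by (rule nn_integral_cmult) measurable
    finally show ?thesis .
  qed
  have "tangential_const p a n \<le> (\<integral>\<^sup>+s. (ennreal L * (ennreal K * I)) * indicator {-n..n} s \<partial>lborel)"
    unfolding tangential_const_def
  proof (rule nn_integral_mono)
    fix s
    show "ennreal (exp ((1 + 2 * p - a) * s) * tent n s) *
       (\<integral>\<^sup>+r. ennreal (exp (p * r) * tent n (s + r)) * ennreal (exp (- ((a - 1) / 2) * r) * log_kernel a r) \<partial>lborel)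
      \<le> (ennreal L * (ennreal K * I)) * indicator {-n..n} s"
    proof (cases "s \<in> {-n..n}")
      case True
      have "(1 + 2 * p - a) * s \<le> \<bar>1 + 2 * p - a\<bar> * n"
        using mult_le_abs_mult[of s n "1 + 2 * p - a"] True by auto
      then have "exp ((1 + 2 * p - a) * s) * tent n s \<le> L * 1"
        unfolding L_def using n by (intro mult_mono tent_bounds) auto
      from mult_mono[OF ennreal_leI[OF this] inner[OF True]] show ?thesis
        using True by simp
    next
      case False
      then have "tent n s = 0" using n by (intro tent_eq_0) auto
      then show ?thesis by simp
    qed
  qed
  also have "\<dots> = (ennreal L * (ennreal K * I)) * emeasure lborel {-n..n}"
    by (rule nn_integral_cmult_indicator) simp
  also have "\<dots> < \<top>" using I n by (simp add: ennreal_mult_less_top)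
  finally show ?thesis .
qed

text \<open>The gap between the two sides is \<open>(f * g' - f' * g)^2\<close>. Pairing
  \<open>(g - g')^2\<close> with \<open>f * f'\<close> instead of \<open>f^2\<close> or
  \<open>f'^2\<close> is the point: both heights are then confined, not just one.\<close>

lemma square_diff_product_le:
  fixes f g f' g' :: real
  shows "(f * g - f' * g')\<^sup>2 \<le> (f - f')\<^sup>2 * (g\<^sup>2 + g'\<^sup>2) + 2 * (f * f') * (g - g')\<^sup>2"
proof -
  have "(f - f')\<^sup>2 * (g\<^sup>2 + g'\<^sup>2) + 2 * (f * f') * (g - g')\<^sup>2 - (f * g - f' * g')\<^sup>2 = (f * g' - f' * g)\<^sup>2"
    by (simp add: power2_eq_square algebra_simps)
  then show ?thesis using zero_le_power2[of "f * g' - f' * g"] by linarith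
qed

text \<open>
  The cross term carries the factor \<open>f f'\<close>, hence is supported where both points have bounded height.
  There the Lipschitz bound, interpolated to the exponent \<open>b\<close> with \<open>a < b < a + 1\<close>, makes it integrable
  and of relative size \<open>R powr (- b)\<close>.
\<close>

lemma dint_ground_trial:
  fixes a :: real
  assumes a: "0 < a" "a < 2" and R: "R > 0"
  defines "p \<equiv> (a - 1) / 2" and "b \<equiv> a / 2 + 1"
  shows "1/2 * dint k (ground_density a k (trial n R k :: real^'n::finite \<Rightarrow> real))
    \<le> ennreal (slice_const CARD('n) a) * ((\<integral>\<^sup>+t. ennreal ((tent R t)\<^sup>2) \<partial>lborel) ^ (CARD('n) - 1) *
       (\<integral>\<^sup>+s. (\<integral>\<^sup>+r. ennreal ((tent n s - tent n (s + r))\<^sup>2 * log_kernel a r) \<partial>lborel) \<partial>lborel))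
      + ennreal (2 * (real CARD('n) / R) powr b) * (ennreal (slice_const CARD('n) (a - b)) * (ennreal (2 * R) ^ (CARD('n) - 1) * tangential_const p (a - b) n))"
proof -
  define c where "c = 2 * (real CARD('n) / R) powr b"
  define F1 where "F1 = (\<lambda>(x, y::real^'n). ennreal ((x $ k) powr p * (y $ k) powr p *
      ((tent n (ln (x $ k)) - tent n (ln (y $ k)))\<^sup>2 * (cutoff R k y)\<^sup>2) * norm (x - y) powr (- (real CARD('n) + a))))"
  define F2 where "F2 = (\<lambda>(x, y::real^'n). side_box R k y * ennreal ((x $ k) powr p * (y $ k) powr p *
      (tent n (ln (x $ k)) * tent n (ln (y $ k))) * norm (x - y) powr (- (real CARD('n) + (a - b)))))"
  have [measurable]: "F1 \<in> borel_measurable (borel \<Otimes>\<^sub>M borel)" "F2 \<in> borel_measurable (borel \<Otimes>\<^sub>M borel)"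
    unfolding F1_def F2_def by measurable
  \<comment> \<open>\<open>b\<close> is the midpoint of \<open>a\<close> and 2, which lies below
    \<open>a + 1\<close> because \<open>a > 0\<close>.\<close>
  have b: "0 < b" "b \<le> 2" "a - b > -1" using a by (auto simp: b_def)
  have pointwise: "ground_density a k (trial n R k) (x, y) \<le> (F1 (x, y) + F1 (y, x)) + ennreal c * (F2 (x, y) + F2 (y, x))" for x y :: "real^'n"
  proof -
    define N where "N = norm (x - y) powr (- (real CARD('n) + a))"
    define w where "w = (x $ k) powr p * (y $ k) powr p"
    define f where "f = tent n (ln (x $ k))"
    define f' where "f' = tent n (ln (y $ k))"
    define g where "g = cutoff R k x"
    define g' where "g' = cutoff R k y"
    have nonneg: "N \<ge> 0" "w \<ge> 0" "f \<ge> 0" "f' \<ge> 0" "c \<ge> 0" by (auto simp: N_def w_def f_def f'_def c_def tent_bounds)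
    have N_sym: "norm (y - x) powr (- (real CARD('n) + a)) = N" by (simp add: N_def norm_minus_commute)
    define N' where "N' = norm (x - y) powr (- (real CARD('n) + (a - b)))"
    have N'_sym: "norm (y - x) powr (- (real CARD('n) + (a - b))) = N'" by (simp add: N'_def norm_minus_commute)
    have "b + - (real CARD('n) + a) = - (real CARD('n) + (a - b))" by simp
    then have N': "norm (x - y) powr b * N = N'" unfolding N_def N'_def by (simp only: powr_add[symmetric])
    have w_sym: "(y $ k) powr p * (x $ k) powr p = w" by (simp add: w_def mult.commute)
    have F1: "F1 (x, y) + F1 (y, x) = ennreal (w * ((f - f')\<^sup>2 * (g\<^sup>2 + g'\<^sup>2)) * N)"
      unfolding F1_def prod.case N_sym N_def[symmetric] w_sym w_def[symmetric] f_def[symmetric] f'_def[symmetric] g_def[symmetric] g'_def[symmetric]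
      using nonneg by (subst ennreal_plus[symmetric]) (auto simp: algebra_simps power2_commute)
    have F2: "F2 (x, y) + F2 (y, x) = (side_box R k x + side_box R k y) * ennreal (w * (f * f') * N')"
      unfolding F2_def prod.case N'_sym N'_def[symmetric] w_sym w_def[symmetric] f_def[symmetric] f'_def[symmetric]
      by (simp add: algebra_simps)
    \<comment> \<open>If \<open>g\<close> and \<open>g'\<close> do not both vanish, at least one of
      the two points lies in the box. It may be either, which is why \<open>F2\<close> is summed
      over both orders of the pair.\<close>
    have T2: "ennreal (w * (2 * (f * f') * (g - g')\<^sup>2) * N) \<le> ennreal c * (F2 (x, y) + F2 (y, x))"
    proof (cases "g = 0 \<and> g' = 0")
      case False
      then have "side_box R k x = 1 \<or> side_box R k y = 1"
        using side_box_eq_1[OF R] by (auto simp: g_def g'_def)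
      then have 1: "1 \<le> side_box R k x + side_box R k y" by auto
      have "(g - g')\<^sup>2 \<le> (real CARD('n) / R) powr b * norm (x - y) powr b"
        unfolding g_def g'_def by (rule cutoff_diff_square_le[OF R b(1,2)])
      then have "w * (2 * (f * f') * (g - g')\<^sup>2) * N \<le> w * (2 * (f * f') * ((real CARD('n) / R) powr b * norm (x - y) powr b)) * N"
        using nonneg by (intro mult_right_mono mult_left_mono) auto
      also have "\<dots> = c * (w * (f * f') * N')"
        unfolding c_def N'[symmetric] by (simp only: mult_ac)
      finally have "ennreal (w * (2 * (f * f') * (g - g')\<^sup>2) * N) \<le> ennreal (c * (w * (f * f') * N'))"
        by (rule ennreal_leI)
      also have "\<dots> = ennreal c * (1 * ennreal (w * (f * f') * N'))"
        using nonneg by (simp add: ennreal_mult')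
      also have "\<dots> \<le> ennreal c * ((side_box R k x + side_box R k y) * ennreal (w * (f * f') * N'))"
        by (intro mult_left_mono mult_right_mono 1) auto
      finally show ?thesis unfolding F2 .
    qed simp
    have "ground_density a k (trial n R k) (x, y) = ennreal (w * (f * g - f' * g')\<^sup>2 * N)"
      unfolding ground_density_def trial_def prod.case p_def[symmetric] N_def w_def f_def f'_def g_def g'_def ..
    also have "\<dots> \<le> ennreal (w * ((f - f')\<^sup>2 * (g\<^sup>2 + g'\<^sup>2)) * N + w * (2 * (f * f') * (g - g')\<^sup>2) * N)"
    proof (rule ennreal_leI)
      have "w * (f * g - f' * g')\<^sup>2 * N \<le> w * ((f - f')\<^sup>2 * (g\<^sup>2 + g'\<^sup>2) + 2 * (f * f') * (g - g')\<^sup>2) * N"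
        using nonneg by (intro mult_right_mono mult_left_mono square_diff_product_le)
      then show "w * (f * g - f' * g')\<^sup>2 * N \<le> w * ((f - f')\<^sup>2 * (g\<^sup>2 + g'\<^sup>2)) * N + w * (2 * (f * f') * (g - g')\<^sup>2) * N"
        by (simp only: distrib_left distrib_right)
    qed
    also have "\<dots> = ennreal (w * ((f - f')\<^sup>2 * (g\<^sup>2 + g'\<^sup>2)) * N) + ennreal (w * (2 * (f * f') * (g - g')\<^sup>2) * N)"
      using nonneg by (intro ennreal_plus) auto
    also have "\<dots> \<le> (F1 (x, y) + F1 (y, x)) + ennreal c * (F2 (x, y) + F2 (y, x))"
      unfolding F1 using T2 by (rule add_left_mono)
    finally show ?thesis .
  qed
  have "dint k (ground_density a k (trial n R k)) \<le> dint k (\<lambda>z. (F1 z + (\<lambda>(x, y). F1 (y, x)) z) + ennreal c * (F2 z + (\<lambda>(x, y). F2 (y, x)) z))"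
    by (rule dint_mono) (simp add: pointwise)
  also have "\<dots> = 2 * (dint k F1 + ennreal c * dint k F2)"
    by (subst dint_add, measurable) (subst dint_cmult, measurable, simp add: dint_symmetrize distrib_left mult_ac)
  finally have "1/2 * dint k (ground_density a k (trial n R k)) \<le> 1/2 * (2 * (dint k F1 + ennreal c * dint k F2))"
    by (rule mult_left_mono) simp
  also have "\<dots> = dint k F1 + ennreal c * dint k F2" by (rule half_double_ennreal)
  also have "dint k F1 = ennreal (slice_const CARD('n) a) * ((\<integral>\<^sup>+t. ennreal ((tent R t)\<^sup>2) \<partial>lborel) ^ (CARD('n) - 1) *
       (\<integral>\<^sup>+s. (\<integral>\<^sup>+r. ennreal ((tent n s - tent n (s + r))\<^sup>2 * log_kernel a r) \<partial>lborel) \<partial>lborel))"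
    unfolding F1_def p_def by (rule dint_trial_normal[OF a])
  also have "dint k F2 = ennreal (slice_const CARD('n) (a - b)) * (ennreal (2 * R) ^ (CARD('n) - 1) * tangential_const p (a - b) n)"
    unfolding F2_def by (rule dint_trial_tangential[OF b(3) R])
  finally show ?thesis unfolding c_def .
qed

section \<open>Trial functions and optimality\<close>

text \<open>
  Below the height \<open>exp (- n)\<close> the maximum makes the tent vanish; it keeps \<open>ln\<close> and \<open>powr\<close> away from
  nonpositive arguments, so that the function is continuous on the whole space.
\<close>

definition trial_fun :: "real \<Rightarrow> real \<Rightarrow> real \<Rightarrow> 'n \<Rightarrow> real^'n::finite \<Rightarrow> real" where
  "trial_fun p n R k x = (max (x $ k) (exp (- n))) powr p * (tent n (ln (max (x $ k) (exp (- n)))) * cutoff R k x)"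

lemma trial_fun_eq:
  assumes n: "n > 0" and x: "x \<in> half_space k"
  shows "trial_fun p n R k x = (x $ k) powr p * trial n R k x"
proof (cases "x $ k \<ge> exp (- n)")
  case True
  then show ?thesis by (simp add: trial_fun_def trial_def max_absorb1)
next
  case False
  have x: "x $ k > 0" using x by (simp add: half_space_def)
  have "ln (x $ k) \<le> ln (exp (- n))" using False x by (subst ln_le_cancel_iff) auto
  then have "tent n (ln (x $ k)) = 0" using n by (intro tent_eq_0) auto
  moreover have "tent n (ln (max (x $ k) (exp (- n)))) = 0" using False n by (intro tent_eq_0) (auto simp: max_absorb2)
  ultimately show ?thesis by (simp add: trial_fun_def trial_def)
qed

lemma trial_fun_Cc:
  fixes k :: "'n::finite"
  assumes n: "n > 0" and R: "R > 0"
  shows "trial_fun p n R k \<in> Cc (half_space k)"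
proof -
  define K where "K = cbox (\<chi> i. if i = k then exp (- n) else - R) (\<chi> i. if i = k then exp n else R)"
  have "continuous_on UNIV (\<lambda>x::real^'n. max (x $ k) (exp (- n)))"
    by (intro continuous_intros)
  moreover have pos: "max t (exp (- n)) > 0" for t by (simp add: less_max_iff_disj)
  then have ne: "max t (exp (- n)) \<noteq> 0" for t by (metis less_irrefl)
  ultimately have "continuous_on UNIV (trial_fun p n R k)"
    unfolding trial_fun_def cutoff_def by (intro continuous_intros) (auto simp: ne less_imp_le[OF pos])
  moreover have "{x. trial_fun p n R k x \<noteq> 0} \<subseteq> K"
  proof
    fix x :: "real^'n" assume "x \<in> {x. trial_fun p n R k x \<noteq> 0}"
    then have nz: "tent n (ln (max (x $ k) (exp (- n)))) \<noteq> 0" "cutoff R k x \<noteq> 0" by (auto simp: trial_fun_def)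
    then have l: "\<bar>ln (max (x $ k) (exp (- n)))\<bar> < n" using tent_eq_0[OF n] by (meson not_le)
    have "exp (- n) < x $ k"
    proof (rule ccontr)
      assume "\<not> exp (- n) < x $ k"
      then show False using l n by (simp add: max_absorb2)
    qed
    moreover from this have "ln (x $ k) < n" "x $ k > 0" using l less_trans[OF exp_gt_zero] by (auto simp: max_absorb1)
    then have "x $ k < exp n" using ln_less_cancel_iff[of "x $ k" "exp n"] by simp
    ultimately show "x \<in> K"
      using cutoff_nonzero[OF R nz(2)] by (auto simp: K_def mem_box_cart abs_le_iff minus_le_iff)
  qed
  then have cl: "closure {x. trial_fun p n R k x \<noteq> 0} \<subseteq> K"
    by (rule closure_minimal) (simp add: K_def closed_cbox)
  moreover have "compact (closure {x. trial_fun p n R k x \<noteq> 0})"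
    using cl bounded_subset[OF bounded_cbox cl[unfolded K_def]] by (simp add: compact_eq_bounded_closed)
  moreover have "K \<subseteq> half_space k"
  proof
    fix x assume "x \<in> K"
    then have "exp (- n) \<le> x $ k" unfolding K_def mem_box_cart by (auto dest: spec[of _ k])
    then show "x \<in> half_space k" unfolding half_space_def using less_le_trans[OF exp_gt_zero] by simp
  qed
  ultimately show ?thesis
    unfolding Cc_def using cl by blast
qed

text \<open>The squared weight \<open>(x $ k) powr (a - 1)\<close> turns the Hardy weight into the
  logarithmic density, so the integral factors into tangential and height parts.\<close>

lemma hardy_integral_trial_fun:
  fixes a :: real
  assumes n: "n > 0"
  shows "hardy_integral a k (trial_fun ((a - 1) / 2) n R k :: real^'n::finite \<Rightarrow> real)
    = (\<integral>\<^sup>+t. ennreal ((tent R t)\<^sup>2) \<partial>lborel) ^ (CARD('n) - 1) * (\<integral>\<^sup>+s. ennreal ((tent n s)\<^sup>2) \<partial>lborel)"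
proof -
  have "hardy_integral a k (trial_fun ((a - 1) / 2) n R k :: real^'n \<Rightarrow> real)
    = (\<integral>\<^sup>+x\<in>half_space k. (\<Prod>i\<in>UNIV - {k}. ennreal ((tent R ((x::real^'n) $ i))\<^sup>2)) * (ennreal ((tent n (ln (x $ k)))\<^sup>2) * ennreal ((x $ k) powr (-1))) \<partial>lborel)"
    unfolding hardy_integral_def
  proof (rule nn_integral_cong)
    fix x :: "real^'n"
    show "ennreal ((trial_fun ((a - 1) / 2) n R k x)\<^sup>2 * (x $ k) powr (- a)) * indicator (half_space k) x
      = (\<Prod>i\<in>UNIV - {k}. ennreal ((tent R (x $ i))\<^sup>2)) * (ennreal ((tent n (ln (x $ k)))\<^sup>2) * ennreal ((x $ k) powr (-1))) * indicator (half_space k) x"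
    proof (cases "x \<in> half_space k")
      case True
      then have x: "x $ k > 0" by (simp add: half_space_def)
      have "((x $ k) powr ((a - 1) / 2))\<^sup>2 = (x $ k) powr (a - 1)"
        by (simp add: power2_eq_square flip: powr_add)
      then have 1: "((x $ k) powr ((a - 1) / 2))\<^sup>2 * (x $ k) powr (- a) = (x $ k) powr (-1)"
        by (simp flip: powr_add)
      have "(trial_fun ((a - 1) / 2) n R k x)\<^sup>2 * (x $ k) powr (- a)
         = (cutoff R k x)\<^sup>2 * ((tent n (ln (x $ k)))\<^sup>2 * (((x $ k) powr ((a - 1) / 2))\<^sup>2 * (x $ k) powr (- a)))"
        unfolding trial_fun_eq[OF n True] trial_def power_mult_distrib by (simp only: mult_ac)
      then have "ennreal ((trial_fun ((a - 1) / 2) n R k x)\<^sup>2 * (x $ k) powr (- a))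
         = ennreal ((cutoff R k x)\<^sup>2) * (ennreal ((tent n (ln (x $ k)))\<^sup>2) * ennreal ((x $ k) powr (-1)))"
        unfolding 1 by (simp only: ennreal_mult zero_le_power2 powr_ge_zero mult_nonneg_nonneg)
      also have "ennreal ((cutoff R k x)\<^sup>2) = (\<Prod>i\<in>UNIV - {k}. ennreal ((tent R (x $ i))\<^sup>2))"
        unfolding cutoff_def by (simp add: prod_ennreal prod_power_distrib)
      finally show ?thesis by simp
    qed simp
  qed
  also have "\<dots> = (\<integral>\<^sup>+t. ennreal ((tent R t)\<^sup>2) \<partial>lborel) ^ (CARD('n) - 1) * (\<integral>\<^sup>+s. ennreal ((tent n s)\<^sup>2) \<partial>lborel)"
    by (rule nn_integral_half_space_prod) measurable
  finally show ?thesis .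
qed

text \<open>Half of the excess \<epsilon> = \<kappa> - kappa pays for the remainder, a quarter each
  for its normal part (by the choice of \<open>n\<close>) and its tangential part (by the choice of
  \<open>R\<close>). The other half gives strictness.\<close>

lemma fractional_hardy_optimal:
  fixes k :: "'n::finite"
  assumes a: "0 < a" "a < 2" and \<kappa>: "\<kappa> > kappa CARD('n) a"
  shows "\<exists>u \<in> Cc (half_space k). energy a (half_space k) u < ennreal \<kappa> * hardy_integral a k u"
proof -
  define d where "d = CARD('n)"
  define p where "p = (a - 1) / 2"
  define b where "b = a / 2 + 1"
  define \<epsilon> where "\<epsilon> = \<kappa> - kappa d a"
  have \<epsilon>: "\<epsilon> > 0" using \<kappa> by (simp add: \<epsilon>_def d_def)
  have b: "1 \<le> b" "-1 < a - b" "a - b < 0" using a by (auto simp: b_def)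
  define C where "C = slice_const d a"
  have C: "C \<ge> 0" unfolding C_def by (rule slice_const_nonneg[OF a(1)])
  obtain M where M: "M \<ge> 0" "(\<integral>\<^sup>+r. ennreal (r\<^sup>2 * log_kernel a r) \<partial>lborel) = ennreal M"
    using log_kernel_second_moment[OF a] by (cases "\<integral>\<^sup>+r. ennreal (r\<^sup>2 * log_kernel a r) \<partial>lborel" rule: ennreal_cases) auto
  \<comment> \<open>The requirement is \<open>64 * C * M \<le> \<epsilon> * n^2\<close>, where 64
    collects the 4 of the tent energy, the 4 of the tent mass and the 4 of \<epsilon> / 4. The
    summand 1 gives \<open>n \<le> n^2\<close>.\<close>
  define n where "n = 1 + 64 * C * M / \<epsilon>"
  have n: "n \<ge> 1" using C M \<epsilon> by (simp add: n_def)
  have n_bound: "C * (4 / n * M) \<le> \<epsilon> / 4 * (n / 4)"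
  proof -
    have "64 * C * M = (n - 1) * \<epsilon>" using \<epsilon> by (simp add: n_def)
    also have "\<dots> \<le> n * \<epsilon>" using n \<epsilon> by (intro mult_right_mono) auto
    also have "\<dots> \<le> n * n * \<epsilon>" using n \<epsilon> by (intro mult_right_mono) auto
    finally show ?thesis using n by (simp add: field_simps)
  qed
  \<comment> \<open>The passage through \<open>ennreal\<close> yields a nonnegative real without a
    discussion of the sign of \<open>slice_const\<close> at the negative exponent
    \<open>a - b\<close>.\<close>
  define C' where "C' = enn2real (ennreal (slice_const d (a - b)))"
  have C': "C' \<ge> 0" "ennreal (slice_const d (a - b)) = ennreal C'" by (simp_all add: C'_def)
  have n0: "n > 0" using n by simp
  obtain m where m: "m \<ge> 0" "tangential_const p (a - b) n = ennreal m"
    using tangential_const_finite[OF n0 b(2,3), of p] by (cases "tangential_const p (a - b) n" rule: ennreal_cases) auto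
  \<comment> \<open>Writing \<open>2 * R\<close> as \<open>8 * (R / 4)\<close> cancels the powers
    \<open>d - 1\<close> of \<open>R\<close> between error and Hardy integral. The remaining
    condition is \<open>Q \<le> R powr b\<close>, and \<open>R \<ge> max 1 Q\<close> suffices
    because \<open>b \<ge> 1\<close>.\<close>
  define Q where "Q = 2 * real d powr b * C' * 8 ^ (d - 1) * m * 16 / (\<epsilon> * n)"
  define R where "R = max 1 Q"
  have R: "R \<ge> 1" "R \<ge> Q" by (auto simp: R_def)
  have R_bound: "2 * (real d / R) powr b * (C' * ((2 * R) ^ (d - 1) * m)) \<le> \<epsilon> / 4 * ((R / 4) ^ (d - 1) * (n / 4))"
  proof -
    have "R powr 1 \<le> R powr b" using R b by (intro powr_mono) auto
    then have "Q \<le> R powr b" using R by simp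
    then have "Q * (\<epsilon> * n) \<le> R powr b * (\<epsilon> * n)" using \<epsilon> n0 by (intro mult_right_mono) auto
    then have 1: "2 * real d powr b * C' * 8 ^ (d - 1) * m * 16 \<le> R powr b * (\<epsilon> * n)"
      unfolding Q_def using \<epsilon> n0 by simp
    have "2 * (real d / R) powr b * (C' * ((2 * R) ^ (d - 1) * m)) = (2 * real d powr b * C' * 8 ^ (d - 1) * m * 16) * ((R / 4) ^ (d - 1) / (16 * R powr b))"
    proof -
      have "2 * R = 8 * (R / 4)" by simp
      then have "(2 * R) ^ (d - 1) = 8 ^ (d - 1) * (R / 4) ^ (d - 1)" by (simp only: power_mult_distrib)
      moreover have "(real d / R) powr b = real d powr b / R powr b" using R by (intro powr_divide)
      ultimately show ?thesis by simp
    qed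
    also have "\<dots> \<le> (R powr b * (\<epsilon> * n)) * ((R / 4) ^ (d - 1) / (16 * R powr b))"
      using R by (intro mult_right_mono 1) auto
    also have "\<dots> = \<epsilon> / 4 * ((R / 4) ^ (d - 1) * (n / 4))" using R by simp
    finally show ?thesis .
  qed
  have R0: "R > 0" using R by simp
  define u where "u = (trial_fun p n R k :: real^'n \<Rightarrow> real)"
  have u: "u \<in> Cc (half_space k)" unfolding u_def by (rule trial_fun_Cc[OF n0 R0])
  have [measurable]: "u \<in> borel_measurable borel"
    using u by (auto simp: Cc_def intro: borel_measurable_continuous_onI)
  define \<Theta> where "\<Theta> = (\<integral>\<^sup>+t. ennreal ((tent R t)\<^sup>2) \<partial>lborel) ^ (d - 1)"
  define N where "N = (\<integral>\<^sup>+s. ennreal ((tent n s)\<^sup>2) \<partial>lborel)"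
  define h where "h = hardy_integral a k u"
  have h: "h = \<Theta> * N"
    unfolding h_def u_def p_def \<Theta>_def N_def d_def by (rule hardy_integral_trial_fun[OF n0])
  have h_finite: "h < \<top>" unfolding h_def by (rule hardy_integral_finite[OF u a(1)])
  have N: "ennreal (n / 4) \<le> N" unfolding N_def by (rule tent_square_integral_ge[OF n0])
  have \<Theta>: "ennreal ((R / 4) ^ (d - 1)) \<le> \<Theta>"
    unfolding \<Theta>_def using R0 tent_square_integral_ge[OF R0] by (simp add: ennreal_power[symmetric] power_mono)
  have h_ge: "ennreal ((R / 4) ^ (d - 1) * (n / 4)) \<le> h"
  proof -
    have "ennreal ((R / 4) ^ (d - 1) * (n / 4)) = ennreal ((R / 4) ^ (d - 1)) * ennreal (n / 4)"
      using R0 n0 by (intro ennreal_mult) auto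
    also have "\<dots> \<le> \<Theta> * N" by (intro mult_mono \<Theta> N) auto
    finally show ?thesis unfolding h .
  qed
  have "0 < ennreal ((R / 4) ^ (d - 1) * (n / 4))" using R0 n0 by simp
  then have h_pos: "0 < h" using h_ge by (rule less_le_trans)
  have G: "1/2 * dint k (ground_density a k (\<lambda>x. u x / (x $ k) powr ((a - 1) / 2))) \<le> ennreal (\<epsilon> / 2) * h"
  proof -
    have "dint k (ground_density a k (\<lambda>x. u x / (x $ k) powr ((a - 1) / 2))) = dint k (ground_density a k (trial n R k))"
    proof (rule dint_cong)
      fix x y :: "real^'n" assume xy: "x \<in> half_space k" "y \<in> half_space k"
      have "u x / (x $ k) powr ((a - 1) / 2) = trial n R k x" if "x \<in> half_space k" for x
        using that trial_fun_eq[OF n0 that, of p R] by (simp add: u_def p_def half_space_def)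
      with xy show "ground_density a k (\<lambda>x. u x / (x $ k) powr ((a - 1) / 2)) (x, y) = ground_density a k (trial n R k) (x, y)"
        unfolding ground_density_def by simp
    qed
    then have "1/2 * dint k (ground_density a k (\<lambda>x. u x / (x $ k) powr ((a - 1) / 2))) = 1/2 * dint k (ground_density a k (trial n R k))"
      by simp
    also have "\<dots> \<le> ennreal C * (\<Theta> * (\<integral>\<^sup>+s. (\<integral>\<^sup>+r. ennreal ((tent n s - tent n (s + r))\<^sup>2 * log_kernel a r) \<partial>lborel) \<partial>lborel))
      + ennreal (2 * (real d / R) powr b) * (ennreal (slice_const d (a - b)) * (ennreal (2 * R) ^ (d - 1) * tangential_const p (a - b) n))"
      unfolding C_def \<Theta>_def d_def b_def p_def by (rule dint_ground_trial[OF a R0])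
    also have "\<dots> \<le> ennreal (\<epsilon> / 4) * h + ennreal (\<epsilon> / 4) * h"
    proof (rule add_mono)
      have "ennreal C * (\<Theta> * (\<integral>\<^sup>+s. (\<integral>\<^sup>+r. ennreal ((tent n s - tent n (s + r))\<^sup>2 * log_kernel a r) \<partial>lborel) \<partial>lborel))
         \<le> ennreal C * (\<Theta> * (ennreal (4 / n) * ennreal M))"
        using tent_log_energy[OF n0, of a] unfolding M(2) by (intro mult_left_mono) auto
      also have "\<dots> = \<Theta> * (ennreal C * (ennreal (4 / n) * ennreal M))" by (simp only: mult_ac)
      also have "ennreal C * (ennreal (4 / n) * ennreal M) = ennreal (C * (4 / n * M))"
        using C M n0 by (simp only: ennreal_mult[symmetric] mult_nonneg_nonneg divide_nonneg_pos zero_le_numeral)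
      also have "\<Theta> * ennreal (C * (4 / n * M)) \<le> \<Theta> * ennreal (\<epsilon> / 4 * (n / 4))"
        by (intro mult_left_mono ennreal_leI n_bound) auto
      also have "\<dots> = ennreal (\<epsilon> / 4) * (\<Theta> * ennreal (n / 4))"
        using \<epsilon> n0 by (subst ennreal_mult) (simp_all add: mult_ac)
      \<comment> \<open>\<Theta> is a common factor of this term and of \<open>h\<close>, so only
        the lower bound for the height factor \<open>N\<close> is used.\<close>
      also have "\<dots> \<le> ennreal (\<epsilon> / 4) * h"
        unfolding h by (intro mult_left_mono N) auto
      finally show "ennreal C * (\<Theta> * (\<integral>\<^sup>+s. (\<integral>\<^sup>+r. ennreal ((tent n s - tent n (s + r))\<^sup>2 * log_kernel a r) \<partial>lborel) \<partial>lborel)) \<le> ennreal (\<epsilon> / 4) * h" .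
      have "ennreal (2 * (real d / R) powr b) * (ennreal (slice_const d (a - b)) * (ennreal (2 * R) ^ (d - 1) * tangential_const p (a - b) n))
        = ennreal (2 * (real d / R) powr b * (C' * ((2 * R) ^ (d - 1) * m)))"
      proof -
        have "0 \<le> 2 * (real d / R) powr b" "0 \<le> (2 * R) ^ (d - 1)" using R0 by auto
        moreover have "ennreal (2 * R) ^ (d - 1) = ennreal ((2 * R) ^ (d - 1))" using R0 by (simp add: ennreal_power)
        ultimately show ?thesis
          unfolding C'(2) m(2) using C'(1) m(1) by (simp only: ennreal_mult mult_nonneg_nonneg)
      qed
      also have "\<dots> \<le> ennreal (\<epsilon> / 4 * ((R / 4) ^ (d - 1) * (n / 4)))" by (rule ennreal_leI[OF R_bound])
      also have "\<dots> = ennreal (\<epsilon> / 4) * ennreal ((R / 4) ^ (d - 1) * (n / 4))"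
        using \<epsilon> n0 R0 by (intro ennreal_mult) auto
      also have "\<dots> \<le> ennreal (\<epsilon> / 4) * h" by (intro mult_left_mono h_ge) simp
      finally show "ennreal (2 * (real d / R) powr b) * (ennreal (slice_const d (a - b)) * (ennreal (2 * R) ^ (d - 1) * tangential_const p (a - b) n)) \<le> ennreal (\<epsilon> / 4) * h" .
    qed
    also have "\<dots> = ennreal (\<epsilon> / 2) * h"
      using \<epsilon> by (simp flip: distrib_right ennreal_plus)
    finally show ?thesis .
  qed
  have k0: "kappa d a \<ge> 0" by (rule kappa_nonneg[OF a])
  have "energy a (half_space k) u \<le> ennreal (kappa d a) * h + 1/2 * dint k (ground_density a k (\<lambda>x. u x / (x $ k) powr ((a - 1) / 2)))"
    unfolding d_def h_def by (rule energy_le_ground_state[OF a]) (use h_finite in \<open>simp_all add: h_def\<close>)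
  also have "\<dots> \<le> ennreal (kappa d a) * h + ennreal (\<epsilon> / 2) * h"
    by (rule add_left_mono[OF G])
  also have "\<dots> = ennreal (kappa d a + \<epsilon> / 2) * h"
    using k0 \<epsilon> by (simp flip: distrib_right ennreal_plus)
  \<comment> \<open>Strictness survives the multiplication because \<open>h\<close> is positive and
    finite.\<close>
  also have "\<dots> < ennreal \<kappa> * h"
  proof -
    have "ennreal (kappa d a + \<epsilon> / 2) < ennreal \<kappa>"
      using k0 \<epsilon> by (intro ennreal_lessI) (auto simp: \<epsilon>_def field_simps)
    then show ?thesis using h_pos h_finite by (intro ennreal_mult_strict_right_mono)
  qed
  finally show ?thesis using u unfolding h_def by blast
qed

theorem theorem1:
  fixes \<alpha> :: real and k :: "'n::finite"
  assumes "0 < \<alpha>" and "\<alpha> < 2"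
  shows "(\<forall>u \<in> Cc (half_space k).
            energy \<alpha> (half_space k) u \<ge> ennreal (kappa CARD('n) \<alpha>) * hardy_integral \<alpha> k u) \<and>
         (\<forall>\<kappa>::real. \<kappa> > kappa CARD('n) \<alpha> \<longrightarrow>
            (\<exists>u \<in> Cc (half_space k).
               energy \<alpha> (half_space k) u < ennreal \<kappa> * hardy_integral \<alpha> k u))"
  using fractional_hardy_inequality[OF assms] fractional_hardy_optimal[OF assms] by blast

end
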